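(* Let $\phi$ be a standardized holey $\{\exists,\wedge\}$-formula and let $a$ be an association for $\phi$. Let $H$ be the hypergraph of $(\phi,a)$. Then $\mathsf{width}([\phi]_{\mathcal{T}\setminus\{N\}})=\mathsf{tw}(H)+1$. Moreover, there exists a polynomial-time algorithm that, given $\phi$, $a$ and a tree decomposition $C$ of $H$, outputs a formula $\phi'\in[\phi]_{\mathcal{T}\setminus\{N\}}$ with $\mathsf{width}(\phi')\le\mathsf{bagsize}(C)$; when $C$ is a minimum width tree decomposition of $H$, $\mathsf{width}(\phi')=\mathsf{bagsize}(C)$.
   Context: A holey pfo-formula is built as follows: each natural number $i\ge1$ is a holey formula (a hole); if $\phi,\phi'$ are holey formulas, so are $\phi\wedge\phi'$, $\phi\vee\phi'$, $\exists x\phi$, $\forall x\phi$ ($x$ a variable); no natural number may occur more than once. A holey $\{\exists,\wedge\}$-formula is one built using only holes, $\wedge$ and $\exists$. An association for a holey formula $\phi$ is a partial map $a$ defined on every hole of $\phi$, with $a(i)$ a set of variables; it determines $\mathrm{free}(\cdot)$ on every subformula by setting $\mathrm{free}(i)=a(i)$ and using the usual inductive rules ($\mathrm{free}(\alpha\wedge\beta)=\mathrm{free}(\alpha)\cup\mathrm{free}(\beta)$, $\mathrm{free}(\exists x\alpha)=\mathrm{free}(\alpha)\setminus\{x\}$, etc.). The width of a (holey) formula is the maximum of $|\mathrm{free}(\psi)|$ over its subformulas $\psi$; for a set $S$, $\mathsf{width}(S)=\inf\{\mathsf{width}(\psi):\psi\in S\}$. A formula is standardized if for each occurrence of a quantification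 $Qx$, the variable $x$ is quantified at no other occurrence and $x\notin\mathrm{free}$ of the whole formula. Rewriting rules (applicable to any subformula occurrence, with free variables computed via the association; $\oplus\in\{\wedge,\vee\}$, $Q\in\{\exists,\forall\}$): $A$: $F_1\oplus(F_2\oplus F_3)\to(F_1\oplus F_2)\oplus F_3$ and its converse; $C$: $F_1\oplus F_2\to F_2\oplus F_1$; $O$: $QxQyF\to QyQxF$; $P\!\downarrow$: $\exists x(F_1\wedge F_2)\to(\exists xF_1)\wedge F_2$ and $\forall x(F_1\vee F_2)\to(\forall xF_1)\vee F_2$ whenever $x\notin\mathrm{free}(F_2)$; $P\!\uparrow$: inverse of $P\!\downarrow$. $\mathcal{T}\setminus\{N\}=\{A,C,O,P\!\downarrow,P\!\uparrow\}$, and $[\phi]_{\mathcal{T}\setminus\{N\}}$ is the equivalence class of $\phi$ under the reflexive-transitive closure of the union of these rules and their inverses. The hypergraph of $(\phi,a)$ has vertex set $\bigcup_i a(i)$ (over holes $i$ of $\phi$) and edge set $\{a(i): i \text{ a hole of }\phi\}\cup\{\mathrm{free}(\phi)\}$. A tree decomposition of a hypergraph $H$ is $(T,\{B_t\}_{t\in V(T)})$ with $T$ a tree and bags $B_t\subseteq V(H)$ such that each vertex is in some bag, each edge is contained in some bag, and for each vertex $v$, $\{t:v\in B_t\}$ induces a connected subtree. $\mathsf{bagsize}(C)=\max_t|B_t|$; $\mathsf{tw}(H)$ is the minimum bagsize over tree decompositions minus $1$; a minimum width tree decomposition attains this minimum. *)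

theory Defs
  imports "HOL-Computational_Algebra.Polynomial"
begin

section \<open>Holey formulas\<close>

text \<open>Variables are natural numbers.\<close>

datatype conn = Conj | Disj
datatype quant = Exists | Forall

datatype hform =
    Hole nat
  | Bin conn hform hform
  | Qu quant nat hform

primrec hole_list :: "hform \<Rightarrow> nat list" where
  "hole_list (Hole i) = [i]"
| "hole_list (Bin c F G) = hole_list F @ hole_list G"
| "hole_list (Qu Q x F) = hole_list F"

definition holes :: "hform \<Rightarrow> nat set" where
  "holes \<phi> = set (hole_list \<phi>)"

definition holey_formula :: "hform \<Rightarrow> bool" where
  "holey_formula \<phi> \<longleftrightarrow> (\<forall>i\<in>holes \<phi>. 1 \<le> i) \<and> distinct (hole_list \<phi>)"

primrec ex_and_formula :: "hform \<Rightarrow> bool" where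
  "ex_and_formula (Hole i) = True"
| "ex_and_formula (Bin c F G) = (c = Conj \<and> ex_and_formula F \<and> ex_and_formula G)"
| "ex_and_formula (Qu Q x F) = (Q = Exists \<and> ex_and_formula F)"

text \<open>The partial map may be defined on further numbers.  As usual, only finitely many variables
  occur freely in a formula, so the sets assigned to the holes are finite.\<close>

type_synonym assoc = "nat \<rightharpoonup> nat set"

definition association :: "assoc \<Rightarrow> hform \<Rightarrow> bool" where
  "association a \<phi> \<longleftrightarrow> holes \<phi> \<subseteq> dom a \<and> (\<forall>i\<in>holes \<phi>. finite (the (a i)))"

primrec free :: "assoc \<Rightarrow> hform \<Rightarrow> nat set" where
  "free a (Hole i) = the (a i)"
| "free a (Bin c F G) = free a F \<union> free a G"
| "free a (Qu Q x F) = free a F - {x}"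

primrec subformulas :: "hform \<Rightarrow> hform set" where
  "subformulas (Hole i) = {Hole i}"
| "subformulas (Bin c F G) = insert (Bin c F G) (subformulas F \<union> subformulas G)"
| "subformulas (Qu Q x F) = insert (Qu Q x F) (subformulas F)"

definition width :: "assoc \<Rightarrow> hform \<Rightarrow> nat" where
  "width a \<phi> = Max ((\<lambda>\<psi>. card (free a \<psi>)) ` subformulas \<phi>)"

definition width_set :: "assoc \<Rightarrow> hform set \<Rightarrow> nat" where
  "width_set a S = Inf (width a ` S)"

text \<open>One list entry per occurrence of a quantification.\<close>

primrec quantified_vars :: "hform \<Rightarrow> nat list" where
  "quantified_vars (Hole i) = []"
| "quantified_vars (Bin c F G) = quantified_vars F @ quantified_vars G"
| "quantified_vars (Qu Q x F) = x # quantified_vars F"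

definition standardized :: "assoc \<Rightarrow> hform \<Rightarrow> bool" where
  "standardized a \<phi> \<longleftrightarrow>
     distinct (quantified_vars \<phi>) \<and> set (quantified_vars \<phi>) \<inter> free a \<phi> = {}"

section \<open>Rewriting without renaming\<close>

text \<open>The connective over which a quantifier can be pushed down.\<close>

primrec matching_conn :: "quant \<Rightarrow> conn" where
  "matching_conn Exists = Conj"
| "matching_conn Forall = Disj"

inductive rewrite_rule :: "assoc \<Rightarrow> hform \<Rightarrow> hform \<Rightarrow> bool" for a where
  A: "rewrite_rule a (Bin c F\<^sub>1 (Bin c F\<^sub>2 F\<^sub>3)) (Bin c (Bin c F\<^sub>1 F\<^sub>2) F\<^sub>3)"
| A_converse: "rewrite_rule a (Bin c (Bin c F\<^sub>1 F\<^sub>2) F\<^sub>3) (Bin c F\<^sub>1 (Bin c F\<^sub>2 F\<^sub>3))"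
| C: "rewrite_rule a (Bin c F\<^sub>1 F\<^sub>2) (Bin c F\<^sub>2 F\<^sub>1)"
| O: "rewrite_rule a (Qu Q x (Qu Q y F)) (Qu Q y (Qu Q x F))"
| P_down: "c = matching_conn Q \<Longrightarrow> x \<notin> free a F\<^sub>2 \<Longrightarrow>
    rewrite_rule a (Qu Q x (Bin c F\<^sub>1 F\<^sub>2)) (Bin c (Qu Q x F\<^sub>1) F\<^sub>2)"
| P_up: "c = matching_conn Q \<Longrightarrow> x \<notin> free a F\<^sub>2 \<Longrightarrow>
    rewrite_rule a (Bin c (Qu Q x F\<^sub>1) F\<^sub>2) (Qu Q x (Bin c F\<^sub>1 F\<^sub>2))"

inductive rewrite :: "assoc \<Rightarrow> hform \<Rightarrow> hform \<Rightarrow> bool" for a where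
  at_root: "rewrite_rule a F G \<Longrightarrow> rewrite a F G"
| left: "rewrite a F F' \<Longrightarrow> rewrite a (Bin c F G) (Bin c F' G)"
| right: "rewrite a G G' \<Longrightarrow> rewrite a (Bin c F G) (Bin c F G')"
| under: "rewrite a F F' \<Longrightarrow> rewrite a (Qu Q x F) (Qu Q x F')"

definition rewrite_class :: "assoc \<Rightarrow> hform \<Rightarrow> hform set" where
  "rewrite_class a \<phi> = {\<psi>. equivclp (rewrite a) \<phi> \<psi>}"

section \<open>Hypergraphs and tree decompositions\<close>

record hypergraph =
  hverts :: "nat set"
  hedges :: "nat set set"

definition hypergraph_of :: "hform \<Rightarrow> assoc \<Rightarrow> hypergraph" where
  "hypergraph_of \<phi> a =
     \<lparr>hverts = (\<Union>i\<in>holes \<phi>. the (a i)),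
      hedges = {the (a i) | i. i \<in> holes \<phi>} \<union> {free a \<phi>}\<rparr>"

text \<open>Graphs are undirected and simple: edges are two-element vertex sets.\<close>

definition connected_in :: "nat set set \<Rightarrow> nat set \<Rightarrow> bool" where
  "connected_in E S \<longleftrightarrow>
     (\<forall>u\<in>S. \<forall>v\<in>S. (\<lambda>x y. x \<in> S \<and> y \<in> S \<and> {x, y} \<in> E)\<^sup>*\<^sup>* u v)"

definition cycle_in :: "nat set set \<Rightarrow> nat list \<Rightarrow> bool" where
  "cycle_in E vs \<longleftrightarrow> 3 \<le> length vs \<and> distinct vs \<and>
     (\<forall>i<length vs. {vs ! i, vs ! (Suc i mod length vs)} \<in> E)"

definition tree_graph :: "nat set \<Rightarrow> nat set set \<Rightarrow> bool" where
  "tree_graph V E \<longleftrightarrow> finite V \<and> V \<noteq> {} \<and> (\<forall>e\<in>E. e \<subseteq> V \<and> card e = 2) \<and>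
     connected_in E V \<and> (\<nexists>vs. cycle_in E vs)"

record tree_decomp =
  nodes :: "nat set"
  tedges :: "nat set set"
  bag :: "nat \<Rightarrow> nat set"

definition tree_decomposition :: "hypergraph \<Rightarrow> tree_decomp \<Rightarrow> bool" where
  "tree_decomposition H D \<longleftrightarrow>
     tree_graph (nodes D) (tedges D) \<and>
     (\<forall>t\<in>nodes D. bag D t \<subseteq> hverts H) \<and>
     (\<forall>v\<in>hverts H. \<exists>t\<in>nodes D. v \<in> bag D t) \<and>
     (\<forall>e\<in>hedges H. \<exists>t\<in>nodes D. e \<subseteq> bag D t) \<and>
     (\<forall>v\<in>hverts H. connected_in (tedges D) {t \<in> nodes D. v \<in> bag D t})"

definition bagsize :: "tree_decomp \<Rightarrow> nat" where
  "bagsize D = Max ((\<lambda>t. card (bag D t)) ` nodes D)"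

definition min_bagsize :: "hypergraph \<Rightarrow> nat" where
  "min_bagsize H = Inf (bagsize ` {D. tree_decomposition H D})"

text \<open>The treewidth is an integer because it is \<open>-1\<close> for a hypergraph without vertices.\<close>

definition tw :: "hypergraph \<Rightarrow> int" where
  "tw H = int (min_bagsize H) - 1"

definition minimum_width :: "hypergraph \<Rightarrow> tree_decomp \<Rightarrow> bool" where
  "minimum_width H D \<longleftrightarrow> tree_decomposition H D \<and> bagsize D = min_bagsize H"

section \<open>Polynomial-time algorithms\<close>

text \<open>
  Algorithms are programs of a first-order functional language over binary trees, in the style of
  Jones, \<^emph>\<open>Computability and Complexity from a Programming Perspective\<close>.  A program is a finite list
  of function bodies; function \<open>0\<close> is the main function.  Variables are de Bruijn indices into the
  current environment: the body of a function is evaluated in the list of its arguments,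
  \<open>Match e e\<^sub>1 e\<^sub>2\<close> adds the two subtrees for \<open>e\<^sub>2\<close>, and \<open>LetE e e\<^sub>1\<close> adds the value of \<open>e\<close>
  for \<open>e\<^sub>1\<close>.

  The last argument of \<open>eval\<close> is the running time: every evaluation step costs one unit.
  With trees represented by pointers, each step of a fixed program takes a bounded number of
  elementary operations, since environments and argument lists have length bounded by the program.
  Conversely the language simulates Turing machines with constant overhead per step.
  Polynomial time in this model is therefore the usual polynomial time, for outputs whose size is
  polynomially bounded.
\<close>

datatype val = Leaf | Node val val

datatype expr =
    Var nat
  | LeafE
  | NodeE expr expr
  | Match expr expr expr
  | LetE expr expr
  | Call nat "expr list"

type_synonym program = "expr list"

inductive eval :: "program \<Rightarrow> val list \<Rightarrow> expr \<Rightarrow> val \<Rightarrow> nat \<Rightarrow> bool"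
  and evals :: "program \<Rightarrow> val list \<Rightarrow> expr list \<Rightarrow> val list \<Rightarrow> nat \<Rightarrow> bool"
  for P where
  Var: "i < length env \<Longrightarrow> eval P env (Var i) (env ! i) 1"
| LeafE: "eval P env LeafE Leaf 1"
| NodeE: "eval P env e\<^sub>1 u m \<Longrightarrow> eval P env e\<^sub>2 v n \<Longrightarrow>
    eval P env (NodeE e\<^sub>1 e\<^sub>2) (Node u v) (m + n + 1)"
| Match_Leaf: "eval P env e Leaf m \<Longrightarrow> eval P env e\<^sub>1 w n \<Longrightarrow>
    eval P env (Match e e\<^sub>1 e\<^sub>2) w (m + n + 1)"
| Match_Node: "eval P env e (Node u v) m \<Longrightarrow> eval P (u # v # env) e\<^sub>2 w n \<Longrightarrow>
    eval P env (Match e e\<^sub>1 e\<^sub>2) w (m + n + 1)"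
| LetE: "eval P env e u m \<Longrightarrow> eval P (u # env) e\<^sub>1 v n \<Longrightarrow>
    eval P env (LetE e e\<^sub>1) v (m + n + 1)"
| Call: "f < length P \<Longrightarrow> evals P env es vs m \<Longrightarrow> eval P vs (P ! f) v n \<Longrightarrow>
    eval P env (Call f es) v (m + n + 1)"
| evals_Nil: "evals P env [] [] 0"
| evals_Cons: "eval P env e v m \<Longrightarrow> evals P env es vs n \<Longrightarrow>
    evals P env (e # es) (v # vs) (m + n)"

definition runs :: "program \<Rightarrow> val \<Rightarrow> val \<Rightarrow> nat \<Rightarrow> bool" where
  "runs P inp out n \<longleftrightarrow> P \<noteq> [] \<and> eval P [inp] (P ! 0) out n"

text \<open>Numbers are encoded in binary, least significant bit first.\<close>

fun enc_nat :: "nat \<Rightarrow> val" where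
  "enc_nat n = (if n = 0 then Leaf
     else Node (if even n then Leaf else Node Leaf Leaf) (enc_nat (n div 2)))"

declare enc_nat.simps [simp del]

primrec enc_list :: "('a \<Rightarrow> val) \<Rightarrow> 'a list \<Rightarrow> val" where
  "enc_list f [] = Leaf"
| "enc_list f (x # xs) = Node (f x) (enc_list f xs)"

definition enc_pair :: "('a \<Rightarrow> val) \<Rightarrow> ('b \<Rightarrow> val) \<Rightarrow> 'a \<times> 'b \<Rightarrow> val" where
  "enc_pair f g p = Node (f (fst p)) (g (snd p))"

primrec enc_conn :: "conn \<Rightarrow> val" where
  "enc_conn Conj = Leaf"
| "enc_conn Disj = Node Leaf Leaf"

primrec enc_quant :: "quant \<Rightarrow> val" where
  "enc_quant Exists = Leaf"
| "enc_quant Forall = Node Leaf Leaf"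

primrec enc_form :: "hform \<Rightarrow> val" where
  "enc_form (Hole i) = Node Leaf (enc_nat i)"
| "enc_form (Bin c F G) =
     Node (Node Leaf Leaf) (Node (enc_conn c) (Node (enc_form F) (enc_form G)))"
| "enc_form (Qu Q x F) =
     Node (Node Leaf (Node Leaf Leaf)) (Node (enc_quant Q) (Node (enc_nat x) (enc_form F)))"

text \<open>Finite sets and maps are given to an algorithm by lists of their elements without
  repetitions, in any order; an edge of the tree is listed in one of its two orientations.  Of the
  association only its restriction to the holes of the formula is given.\<close>

definition lists_set :: "'a list \<Rightarrow> 'a set \<Rightarrow> bool" where
  "lists_set xs A \<longleftrightarrow> distinct xs \<and> set xs = A"

definition lists_association :: "(nat \<times> nat list) list \<Rightarrow> hform \<Rightarrow> assoc \<Rightarrow> bool" where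
  "lists_association al \<phi> a \<longleftrightarrow> lists_set (map fst al) (holes \<phi>) \<and>
     (\<forall>(i, xs)\<in>set al. lists_set xs (the (a i)))"

definition lists_tree_decomp ::
  "(nat \<times> nat list) list \<Rightarrow> (nat \<times> nat) list \<Rightarrow> tree_decomp \<Rightarrow> bool" where
  "lists_tree_decomp bl el D \<longleftrightarrow> lists_set (map fst bl) (nodes D) \<and>
     (\<forall>(t, xs)\<in>set bl. lists_set xs (bag D t)) \<and>
     lists_set (map (\<lambda>(s, t). {s, t}) el) (tedges D)"

definition encodes_input :: "val \<Rightarrow> hform \<Rightarrow> assoc \<Rightarrow> tree_decomp \<Rightarrow> bool" where
  "encodes_input inp \<phi> a D \<longleftrightarrow>
     (\<exists>al bl el. lists_association al \<phi> a \<and> lists_tree_decomp bl el D \<and>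
        inp = Node (enc_form \<phi>)
               (Node (enc_list (enc_pair enc_nat (enc_list enc_nat)) al)
                 (Node (enc_list (enc_pair enc_nat (enc_list enc_nat)) bl)
                       (enc_list (enc_pair enc_nat enc_nat) el))))"

end

theory Submission
  imports Defs
begin

text \<open>
  A standardized \<open>{\<exists>,\<and>}\<close>-formula is equivalent under the rewriting rules to a prenex conjunction of
  its holes, and up to permutation this prenex form depends only on the holes and the quantified
  variables.  Hence the class of \<open>\<phi>\<close> contains every standardized \<open>{\<exists>,\<and>}\<close>-formula with the same
  holes and quantified variables.  The syntax tree of a formula \<open>\<psi>\<close> in the class, with the sets of
  free variables as bags, is a tree decomposition of \<open>H\<close> whose bag size is the width of \<open>\<psi>\<close>.

  Conversely, a tree decomposition of \<open>H\<close> guides a variable elimination.  Two variables are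
  adjacent if they share a bag; this graph is chordal, so as long as quantified variables remain
  there is a simplicial one \<open>x\<close>, that is, one whose bags are all contained in a single bag \<open>B\<close>.  The
  conjunction of the current conjuncts that contain \<open>x\<close> has its free variables in \<open>B\<close>; it is
  quantified by \<open>\<exists>x\<close>, and \<open>x\<close> is deleted from all bags.  The tree is needed only to see that a
  simplicial quantified variable exists, so the algorithm does not look at its edges.
\<close>

text \<open>The edge \<open>free a \<phi>\<close> of \<open>H\<close> accounts for the free
  variables, which may never be eliminated. Some bag contains it, and the tree is rooted there. Free
  variables then have their topmost bag at the root, so the deepest topmost bag of a quantified
  variable is at least as deep as that of any other remaining variable of \<open>H\<close>. The same
  bag bounds the final conjunction, in which only free variables are left. Deleting variables from
  the bags leaves this argument intact. It is therefore applied once, for every possible set of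
  remaining variables, and no tree has to be maintained during the elimination. The rules neither
  create nor destroy quantifiers, so each quantified variable has to be placed exactly once, even if
  it occurs in no hole. The bags of a syntax tree may be disconnected when a variable is quantified
  twice; the lower bound therefore rests on standardization being invariant under rewriting. For the
  running time it matters that partial formulas are assembled but never traversed.\<close>

section \<open>The rewriting class of a standardized formula\<close>

lemma finite_subformulas: "finite (subformulas \<psi>)"
  by (induction \<psi>) auto

lemma self_subformula: "\<psi> \<in> subformulas \<psi>"
  by (cases \<psi>) auto

lemma width_le_iff: "width a \<psi> \<le> k \<longleftrightarrow> (\<forall>\<theta>\<in>subformulas \<psi>. card (free a \<theta>) \<le> k)"
proof -
  have "subformulas \<psi> \<noteq> {}"
    using self_subformula by blast
  then show ?thesis
    unfolding width_def by (simp add: finite_subformulas)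
qed

lemma free_subset_holes: "free a \<psi> \<subseteq> (\<Union>i\<in>holes \<psi>. the (a i))"
  by (induction \<psi>) (auto simp: holes_def)

lemma holes_subset_free: "(\<Union>i\<in>holes \<psi>. the (a i)) \<subseteq> free a \<psi> \<union> set (quantified_vars \<psi>)"
  by (induction \<psi>) (auto simp: holes_def)

lemma standardized_Bin:
  assumes "standardized a (Bin c F G)"
  shows "standardized a F" "standardized a G"
    "set (quantified_vars F) \<inter> free a G = {}" "set (quantified_vars G) \<inter> free a F = {}"
    "set (quantified_vars F) \<inter> set (quantified_vars G) = {}"
  using assms unfolding standardized_def by auto

lemma standardized_Qu:
  assumes "standardized a (Qu Q x F)"
  shows "standardized a F" "x \<notin> set (quantified_vars F)"
  using assms unfolding standardized_def by auto

text \<open>The side condition of the P rules protects the free variables: the quantifier removes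
  nothing from the conjunct that it leaves or takes in.\<close>

lemma rewrite_rule_invariant:
  assumes "rewrite_rule a F G"
  shows "mset (hole_list F) = mset (hole_list G) \<and>
    mset (quantified_vars F) = mset (quantified_vars G) \<and> free a F = free a G"
  using assms by cases auto

lemma rewrite_invariant:
  assumes "rewrite a F G"
  shows "mset (hole_list F) = mset (hole_list G) \<and>
    mset (quantified_vars F) = mset (quantified_vars G) \<and> free a F = free a G"
  using assms
proof induction
  case (at_root F G)
  then show ?case
    by (rule rewrite_rule_invariant)
qed auto

text \<open>Multisets keep the multiplicities on which distinctness of the quantified variables
  rests. A step of \<open>equivclp\<close> may run in either direction, hence both instances of
  \<open>rewrite_invariant\<close>.\<close>

lemma rewrite_class_invariant:
  assumes "\<psi> \<in> rewrite_class a \<phi>"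
  shows "mset (hole_list \<psi>) = mset (hole_list \<phi>) \<and>
    mset (quantified_vars \<psi>) = mset (quantified_vars \<phi>) \<and> free a \<psi> = free a \<phi>"
proof -
  have "equivclp (rewrite a) \<phi> \<psi>"
    using assms by (simp add: rewrite_class_def)
  then show ?thesis
  proof (induction rule: equivclp_induct)
    case (step y z)
    then show ?case
      using rewrite_invariant[of a y z] rewrite_invariant[of a z y] by auto
  qed simp
qed

lemma rewrite_class_standardized:
  assumes "\<psi> \<in> rewrite_class a \<phi>" "standardized a \<phi>"
  shows "standardized a \<psi>"
proof -
  note inv = rewrite_class_invariant[OF assms(1)]
  have "distinct (quantified_vars \<psi>)"
    using inv assms(2) mset_eq_imp_distinct_iff[of "quantified_vars \<psi>" "quantified_vars \<phi>"]
    unfolding standardized_def by simp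
  moreover have "set (quantified_vars \<psi>) = set (quantified_vars \<phi>)"
    using inv mset_eq_setD by blast
  ultimately show ?thesis
    using inv assms(2) unfolding standardized_def by simp
qed

lemma rewrite_class_hypergraph:
  assumes "\<psi> \<in> rewrite_class a \<phi>"
  shows "hypergraph_of \<psi> a = hypergraph_of \<phi> a"
proof -
  have "set (hole_list \<psi>) = set (hole_list \<phi>)"
    using rewrite_class_invariant[OF assms] mset_eq_setD by blast
  then show ?thesis
    using rewrite_class_invariant[OF assms] unfolding hypergraph_of_def holes_def by simp
qed

section \<open>Congruence and prenex forms\<close>

abbreviation equivalent :: "assoc \<Rightarrow> hform \<Rightarrow> hform \<Rightarrow> bool" where
  "equivalent a \<equiv> equivclp (rewrite a)"

lemmas equivalent_trans = equivclp_trans[of "rewrite _"]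
lemmas equivalent_sym = equivclp_sym[of "rewrite _"]

lemma equivalent_map:
  assumes "equivalent a F G" "\<And>F G. rewrite a F G \<Longrightarrow> rewrite a (f F) (f G)"
  shows "equivalent a (f F) (f G)"
  using assms(1)
proof (induction rule: equivclp_induct)
  case (step y z)
  then have "equivalent a (f y) (f z)"
    using assms(2) by blast
  then show ?case
    by (rule equivalent_trans[OF step.IH])
qed simp

lemma equivalent_Qu: "equivalent a F G \<Longrightarrow> equivalent a (Qu Q x F) (Qu Q x G)"
  by (rule equivalent_map) (auto intro: rewrite.under)

lemma equivalent_Bin:
  assumes "equivalent a F F'" "equivalent a G G'"
  shows "equivalent a (Bin c F G) (Bin c F' G')"
proof -
  have "equivalent a (Bin c F G) (Bin c F' G)"
    by (rule equivalent_map[OF assms(1)]) (auto intro: rewrite.left)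
  moreover have "equivalent a (Bin c F' G) (Bin c F' G')"
    by (rule equivalent_map[OF assms(2)]) (auto intro: rewrite.right)
  ultimately show ?thesis
    by (rule equivalent_trans)
qed

lemma equivalent_rule: "rewrite_rule a F G \<Longrightarrow> equivalent a F G"
  by (simp add: r_into_equivclp rewrite.at_root)

definition exs :: "nat list \<Rightarrow> hform \<Rightarrow> hform" where
  "exs xs F = foldr (Qu Exists) xs F"

lemma exs_simps [simp]: "exs [] F = F" "exs (x # xs) F = Qu Exists x (exs xs F)"
  "exs (xs @ ys) F = exs xs (exs ys F)"
  by (simp_all add: exs_def)

text \<open>The value on the empty list is irrelevant.\<close>
fun conj_holes :: "nat list \<Rightarrow> hform" where
  "conj_holes [] = Hole 0"
| "conj_holes [i] = Hole i"
| "conj_holes (i # is) = Bin Conj (Hole i) (conj_holes is)"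

lemma conj_holes_Cons: "is \<noteq> [] \<Longrightarrow> conj_holes (i # is) = Bin Conj (Hole i) (conj_holes is)"
  by (cases "is") auto

lemma equivalent_exs: "equivalent a F G \<Longrightarrow> equivalent a (exs xs F) (exs xs G)"
  by (induction xs) (auto intro: equivalent_Qu)

lemma hole_list_nonempty [simp]: "hole_list F \<noteq> []"
  by (induction F) auto

lemma conj_holes_append:
  "is \<noteq> [] \<Longrightarrow> js \<noteq> [] \<Longrightarrow>
    equivalent a (Bin Conj (conj_holes is) (conj_holes js)) (conj_holes (is @ js))"
proof (induction "is")
  case (Cons i "is")
  show ?case
  proof (cases "is = []")
    case True
    then show ?thesis
      using Cons.prems by (simp add: conj_holes_Cons)
  next
    case False
    have "equivalent a (Bin Conj (Bin Conj (Hole i) (conj_holes is)) (conj_holes js))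
      (Bin Conj (Hole i) (Bin Conj (conj_holes is) (conj_holes js)))"
      by (intro equivalent_rule rewrite_rule.A_converse)
    also have "equivalent a \<dots> (Bin Conj (Hole i) (conj_holes (is @ js)))"
      using Cons.IH[OF False Cons.prems(2)] by (intro equivalent_Bin) auto
    finally show ?thesis
      using False by (simp add: conj_holes_Cons)
  qed
qed simp

text \<open>A and C swap neighbouring conjuncts, so any hole can travel to the front. This is the
  inductive step for permuting one conjunction into another.\<close>

lemma conj_holes_remove:
  assumes "i \<in> set is" "remove1 i is \<noteq> []"
  shows "equivalent a (conj_holes is) (Bin Conj (Hole i) (conj_holes (remove1 i is)))"
  using assms
proof (induction "is")
  case (Cons j js)
  show ?case
  proof (cases "i = j")
    case True
    then show ?thesis
      using Cons.prems by (simp add: conj_holes_Cons)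
  next
    case False
    then have i: "i \<in> set js"
      using Cons.prems by auto
    show ?thesis
    proof (cases "remove1 i js = []")
      case True
      then have js: "js = [i]"
        using i by (cases js) (auto split: if_splits)
      have "equivalent a (Bin Conj (Hole j) (Hole i)) (Bin Conj (Hole i) (Hole j))"
        by (intro equivalent_rule rewrite_rule.C)
      then show ?thesis
        using False js by simp
    next
      case rem: False
      let ?K = "conj_holes (remove1 i js)"
      have "equivalent a (Bin Conj (Hole j) (conj_holes js)) (Bin Conj (Hole j) (Bin Conj (Hole i) ?K))"
        using Cons.IH[OF i rem] by (intro equivalent_Bin) auto
      also have "equivalent a \<dots> (Bin Conj (Bin Conj (Hole j) (Hole i)) ?K)"
        by (intro equivalent_rule rewrite_rule.A)
      also have "equivalent a \<dots> (Bin Conj (Bin Conj (Hole i) (Hole j)) ?K)"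
        by (intro equivalent_Bin[OF equivalent_rule[OF rewrite_rule.C]]) simp
      also have "equivalent a \<dots> (Bin Conj (Hole i) (Bin Conj (Hole j) ?K))"
        by (intro equivalent_rule rewrite_rule.A_converse)
      finally show ?thesis
        using False rem i by (subst conj_holes_Cons) (auto simp: conj_holes_Cons)
    qed
  qed
qed simp

lemma conj_holes_mset:
  "mset is = mset js \<Longrightarrow> equivalent a (conj_holes is) (conj_holes js)"
proof (induction "is" arbitrary: js)
  case (Cons i "is")
  have i: "i \<in> set js"
    using Cons.prems by (metis list.set_intros(1) mset_eq_setD)
  have ms: "mset is = mset (remove1 i js)"
    by (simp flip: Cons.prems)
  show ?case
  proof (cases "is = []")
    case True
    then have "js = [i]"
      using Cons.prems by simp
    then show ?thesis
      using True by simp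
  next
    case False
    then have rem: "remove1 i js \<noteq> []"
      using ms by (metis mset_zero_iff)
    have "equivalent a (conj_holes (i # is)) (Bin Conj (Hole i) (conj_holes (remove1 i js)))"
      using False Cons.IH[OF ms] by (simp add: conj_holes_Cons equivalent_Bin)
    then show ?thesis
      by (rule equivalent_trans[OF _ equivalent_sym[OF conj_holes_remove[OF i rem]]])
  qed
qed simp

lemma exs_remove:
  "x \<in> set xs \<Longrightarrow> equivalent a (exs xs F) (Qu Exists x (exs (remove1 x xs) F))"
proof (induction xs)
  case (Cons y xs)
  show ?case
  proof (cases "x = y")
    case False
    then have "equivalent a (exs xs F) (Qu Exists x (exs (remove1 x xs) F))"
      using Cons by auto
    then have "equivalent a (exs (y # xs) F) (Qu Exists y (Qu Exists x (exs (remove1 x xs) F)))"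
      by (simp add: equivalent_Qu)
    also have "equivalent a \<dots> (Qu Exists x (Qu Exists y (exs (remove1 x xs) F)))"
      by (intro equivalent_rule rewrite_rule.O)
    finally show ?thesis
      using False by auto
  qed simp
qed simp

lemma exs_mset: "mset xs = mset ys \<Longrightarrow> equivalent a (exs xs F) (exs ys F)"
proof (induction xs arbitrary: ys)
  case (Cons x xs)
  have x: "x \<in> set ys"
    using Cons.prems by (metis list.set_intros(1) mset_eq_setD)
  have "mset xs = mset (remove1 x ys)"
    by (simp flip: Cons.prems)
  then have "equivalent a (exs (x # xs) F) (Qu Exists x (exs (remove1 x ys) F))"
    using Cons.IH by (simp add: equivalent_Qu)
  then show ?case
    by (rule equivalent_trans[OF _ equivalent_sym[OF exs_remove[OF x]]])
qed simp

lemma pull_left: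
  "set xs \<inter> free a G = {} \<Longrightarrow>
    equivalent a (Bin Conj (exs xs F) G) (exs xs (Bin Conj F G))"
proof (induction xs)
  case (Cons x xs)
  have "equivalent a (Bin Conj (exs (x # xs) F) G) (Qu Exists x (Bin Conj (exs xs F) G))"
    using Cons.prems by (auto intro!: equivalent_rule rewrite_rule.P_up)
  also have "equivalent a \<dots> (exs (x # xs) (Bin Conj F G))"
    using Cons by (simp add: equivalent_Qu)
  finally show ?case .
qed simp

lemma pull_right:
  assumes "set xs \<inter> free a G = {}"
  shows "equivalent a (Bin Conj G (exs xs F)) (exs xs (Bin Conj G F))"
proof -
  have "equivalent a (Bin Conj G (exs xs F)) (Bin Conj (exs xs F) G)"
    by (intro equivalent_rule rewrite_rule.C)
  also have "equivalent a \<dots> (exs xs (Bin Conj F G))"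
    by (rule pull_left[OF assms])
  also have "equivalent a \<dots> (exs xs (Bin Conj G F))"
    by (intro equivalent_exs equivalent_rule rewrite_rule.C)
  finally show ?thesis .
qed

lemma equivalent_prenex:
  "ex_and_formula F \<Longrightarrow> standardized a F \<Longrightarrow>
    equivalent a F (exs (quantified_vars F) (conj_holes (hole_list F)))"
proof (induction F)
  case (Bin c F G)
  let ?f = "conj_holes (hole_list F)" and ?g = "conj_holes (hole_list G)"
  let ?x = "quantified_vars F" and ?y = "quantified_vars G"
  note st = standardized_Bin[OF Bin.prems(2)]
  have F: "equivalent a F (exs ?x ?f)" and G: "equivalent a G (exs ?y ?g)"
    using Bin.IH Bin.prems st by auto
  \<comment> \<open>With its quantifiers pulled out, the matrix of \<open>F\<close> may have their
    variables free. The quantifiers of \<open>G\<close> must avoid these as well, which is the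
    disjointness of the two sets of quantified variables.\<close>
  have fF: "free a ?f \<subseteq> free a F \<union> set ?x"
  proof -
    have "free a ?f = (\<Union>i\<in>holes F. the (a i))"
    proof -
      have "is \<noteq> [] \<Longrightarrow> free a (conj_holes is) = (\<Union>i\<in>set is. the (a i))" for "is"
        by (induction "is" rule: conj_holes.induct) auto
      then show ?thesis
        by (simp add: holes_def)
    qed
    then show ?thesis
      using holes_subset_free by simp
  qed
  have c: "c = Conj"
    using Bin.prems by simp
  have "equivalent a (Bin Conj F G) (Bin Conj (exs ?x ?f) G)"
    using F by (intro equivalent_Bin) auto
  also have "equivalent a \<dots> (exs ?x (Bin Conj ?f G))"
    by (rule pull_left[OF st(3)])
  also have "equivalent a \<dots> (exs ?x (Bin Conj ?f (exs ?y ?g)))"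
    by (intro equivalent_exs equivalent_Bin G) simp
  also have "equivalent a \<dots> (exs ?x (exs ?y (Bin Conj ?f ?g)))"
    using fF st by (intro equivalent_exs pull_right) auto
  also have "equivalent a \<dots> (exs ?x (exs ?y (conj_holes (hole_list F @ hole_list G))))"
    by (intro equivalent_exs conj_holes_append) auto
  finally show ?case
    using c by simp
next
  case (Qu Q x F)
  then show ?case
    using standardized_Qu[OF Qu.prems(2)] by (auto intro: equivalent_Qu)
qed simp

lemma rewrite_classI:
  assumes "ex_and_formula \<phi>" "standardized a \<phi>" "ex_and_formula \<psi>" "standardized a \<psi>"
    and "mset (hole_list \<psi>) = mset (hole_list \<phi>)"
    and "mset (quantified_vars \<psi>) = mset (quantified_vars \<phi>)"
  shows "\<psi> \<in> rewrite_class a \<phi>"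
proof -
  have "equivalent a \<phi> (exs (quantified_vars \<phi>) (conj_holes (hole_list \<phi>)))"
    using assms by (intro equivalent_prenex)
  also have "equivalent a \<dots> (exs (quantified_vars \<psi>) (conj_holes (hole_list \<phi>)))"
    using assms by (intro exs_mset) simp
  also have "equivalent a \<dots> (exs (quantified_vars \<psi>) (conj_holes (hole_list \<psi>)))"
    using assms by (intro equivalent_exs conj_holes_mset) simp
  also have "equivalent a \<dots> \<psi>"
    using assms by (intro equivalent_sym[OF equivalent_prenex])
  finally show ?thesis
    by (simp add: rewrite_class_def)
qed

section \<open>Tree decompositions\<close>

text \<open>Climbing along \<open>p\<close> lowers \<open>d\<close>, so it must stop, and it can
  stop only at \<open>s\<close>. The lemma serves for the whole tree and for the nodes whose bags
  contain a given variable.\<close>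

lemma connected_in_rooted:
  fixes d :: "nat \<Rightarrow> nat"
  assumes "\<And>t. t \<in> S \<Longrightarrow> t \<noteq> s \<Longrightarrow> p t \<in> S \<and> {t, p t} \<in> E \<and> d (p t) < d t"
  shows "connected_in E S"
proof -
  let ?R = "\<lambda>x y. x \<in> S \<and> y \<in> S \<and> {x, y} \<in> E"
  have up: "?R\<^sup>*\<^sup>* t s" if "t \<in> S" for t
    using that
  proof (induction "d t" arbitrary: t rule: less_induct)
    case less
    show ?case
    proof (cases "t = s")
      case False
      then have "?R t (p t)" "?R\<^sup>*\<^sup>* (p t) s"
        using assms[of t] less by auto
      then show ?thesis
        by (rule converse_rtranclp_into_rtranclp)
    qed simp
  qed
  have "symp ?R"
    by (auto simp: symp_def insert_commute)
  then have "symp ?R\<^sup>*\<^sup>*"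
    by (rule symp_rtranclp)
  then show ?thesis
    unfolding connected_in_def using up by (meson rtranclp_trans sympD)
qed

text \<open>A vertex of greatest depth on a cycle would have its parent as both of its neighbours
  there.\<close>

lemma rooted_no_cycle:
  fixes d :: "nat \<Rightarrow> nat"
  assumes "\<And>e. e \<in> E \<Longrightarrow> \<exists>t. e = {t, p t} \<and> d (p t) < d t"
  shows "\<not> cycle_in E vs"
proof
  assume cyc: "cycle_in E vs"
  define n where "n = length vs"
  have n: "3 \<le> n" and dist: "distinct vs"
    and ed: "\<And>i. i < n \<Longrightarrow> {vs ! i, vs ! (Suc i mod n)} \<in> E"
    using cyc unfolding cycle_in_def n_def by auto
  obtain i where i: "i < n" and max: "\<And>j. j < n \<Longrightarrow> d (vs ! j) \<le> d (vs ! i)"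
  proof -
    have "finite ((\<lambda>j. d (vs ! j)) ` {..<n})" "(\<lambda>j. d (vs ! j)) ` {..<n} \<noteq> {}"
      using n by (auto simp: lessThan_empty_iff)
    from Max_in[OF this] obtain i where i: "i < n" "d (vs ! i) = Max ((\<lambda>j. d (vs ! j)) ` {..<n})"
      by auto
    show thesis
      by (rule that[OF i(1)]) (simp add: i(2))
  qed
  have par: "vs ! j = p (vs ! i)" if j: "j < n" "{vs ! i, vs ! j} \<in> E" for j
  proof -
    obtain t where "{vs ! i, vs ! j} = {t, p t}" "d (p t) < d t"
      using assms[OF j(2)] by blast
    then have "vs ! i = t \<and> vs ! j = p t \<or> vs ! i = p t \<and> vs ! j = t"
      by (simp add: doubleton_eq_iff)
    then show ?thesis
    proof
      assume "vs ! i = p t \<and> vs ! j = t"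
      then show ?thesis
        using max[OF j(1)] \<open>d (p t) < d t\<close> by simp
    qed simp
  qed
  \<comment> \<open>\<open>j\<close> and \<open>k\<close> are the cyclic successor and predecessor
    of \<open>i\<close>; they differ because the length is at least 3.\<close>
  define j where "j = Suc i mod n"
  define k where "k = (if i = 0 then n - 1 else i - 1)"
  have j: "j < n" and k: "k < n" and ki: "Suc k mod n = i" and jk: "j \<noteq> k"
    using n i unfolding j_def k_def by (auto simp: mod_Suc)
  have "{vs ! i, vs ! k} \<in> E"
    using ed[OF k] by (simp add: ki insert_commute)
  then have "vs ! j = p (vs ! i)" "vs ! k = p (vs ! i)"
    using par[OF j] par[OF k] ed[OF i] unfolding j_def[symmetric] by auto
  then show False
    using jk j k dist nth_eq_iff_index_eq unfolding n_def by metis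
qed

lemma tree_graph_rooted:
  fixes d :: "nat \<Rightarrow> nat"
  assumes "finite V" "r \<in> V" "\<And>t. t \<in> V - {r} \<Longrightarrow> p t \<in> V \<and> d (p t) < d t"
  shows "tree_graph V ((\<lambda>t. {t, p t}) ` (V - {r}))" (is "tree_graph V ?E")
proof -
  have "connected_in ?E V"
    by (rule connected_in_rooted[of _ r p _ d]) (use assms in auto)
  moreover have "\<not> cycle_in ?E vs" for vs
    by (rule rooted_no_cycle[of _ p d]) (use assms in auto)
  moreover have "e \<subseteq> V \<and> card e = 2" if "e \<in> ?E" for e
  proof -
    obtain t where t: "t \<in> V - {r}" "e = {t, p t}"
      using \<open>e \<in> ?E\<close> by auto
    then have "p t \<noteq> t"
      using assms(3)[of t] by auto
    then show ?thesis
      using assms(3)[OF t(1)] t by auto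
  qed
  ultimately show ?thesis
    unfolding tree_graph_def using assms(1,2) by blast
qed

section \<open>Syntax trees as tree decompositions\<close>

text \<open>Occurrences of subformulas, as paths from the root.\<close>

primrec positions :: "hform \<Rightarrow> bool list set" where
  "positions (Hole i) = {[]}"
| "positions (Bin c F G) = insert [] (Cons False ` positions F \<union> Cons True ` positions G)"
| "positions (Qu Q x F) = insert [] (Cons False ` positions F)"

text \<open>Defined on all paths: below a hole the remaining directions are ignored, so
  \<open>free_at_subset\<close> holds for every \<open>q\<close>.\<close>

primrec free_at :: "assoc \<Rightarrow> hform \<Rightarrow> bool list \<Rightarrow> nat set" where
  "free_at a (Hole i) = (\<lambda>q. the (a i))"
| "free_at a (Bin c F G) = (\<lambda>q. case q of [] \<Rightarrow> free a F \<union> free a G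
     | b # q' \<Rightarrow> if b then free_at a G q' else free_at a F q')"
| "free_at a (Qu Q x F) = (\<lambda>q. case q of [] \<Rightarrow> free a F - {x} | b # q' \<Rightarrow> free_at a F q')"

lemma finite_positions: "finite (positions \<psi>)"
  by (induction \<psi>) auto

lemma Nil_position [simp]: "[] \<in> positions \<psi>"
  by (cases \<psi>) auto

lemma free_at_Nil [simp]: "free_at a \<psi> [] = free a \<psi>"
  by (cases \<psi>) auto

lemma butlast_position: "q \<in> positions \<psi> \<Longrightarrow> butlast q \<in> positions \<psi>"
proof (induction \<psi> arbitrary: q)
  case (Bin c F G)
  then show ?case
    by (cases q) (auto split: if_splits)
next
  case (Qu Q x F)
  then show ?case
    by (cases q) (auto split: if_splits)
qed simp

lemma free_at_image: "free_at a \<psi> ` positions \<psi> = free a ` subformulas \<psi>"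
  by (induction \<psi>) (simp_all add: image_Un image_image)

lemma free_at_subset: "free_at a \<psi> q \<subseteq> free a \<psi> \<union> set (quantified_vars \<psi>)"
proof (induction \<psi> arbitrary: q)
  case (Bin c F G)
  show ?case
    using Bin.IH[of "tl q"] by (cases q) auto
next
  case (Qu Q x F)
  show ?case
    using Qu.IH[of "tl q"] by (cases q) auto
qed simp

text \<open>This is connectedness in the form that \<open>connected_in_rooted\<close> consumes:
  among the positions with \<open>v\<close> free, all but one have such a parent. Induction works
  because a variable either is free at the root of the part concerned or has its occurrences
  confined to the scope of one quantifier.\<close>

lemma free_at_top:
  assumes "standardized a \<psi>"
  shows "\<exists>s. \<forall>q\<in>positions \<psi>. v \<in> free_at a \<psi> q \<longrightarrow> q = s \<or> q \<noteq> [] \<and> v \<in> free_at a \<psi> (butlast q)"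
  using assms
proof (induction \<psi>)
  case (Bin c F G)
  note st = standardized_Bin[OF Bin.prems]
  obtain s\<^sub>1 where s1: "\<forall>q\<in>positions F. v \<in> free_at a F q \<longrightarrow> q = s\<^sub>1 \<or> q \<noteq> [] \<and> v \<in> free_at a F (butlast q)"
    using Bin.IH st by blast
  obtain s\<^sub>2 where s2: "\<forall>q\<in>positions G. v \<in> free_at a G q \<longrightarrow> q = s\<^sub>2 \<or> q \<noteq> [] \<and> v \<in> free_at a G (butlast q)"
    using Bin.IH st by blast
  have only: "v \<notin> free a \<psi> \<Longrightarrow> v \<notin> set (quantified_vars \<psi>) \<Longrightarrow> v \<notin> free_at a \<psi> q" for \<psi> q
    using free_at_subset by blast
  \<comment> \<open>The root has no parent, so if it carries \<open>v\<close> it must itself be the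
    exceptional position.\<close>
  have root: "v \<in> free a \<psi> \<Longrightarrow> \<forall>q\<in>positions \<psi>. v \<in> free_at a \<psi> q \<longrightarrow> q = s \<or> q \<noteq> [] \<and> v \<in> free_at a \<psi> (butlast q)
      \<Longrightarrow> s = []" for \<psi> s
    by (metis Nil_position free_at_Nil)
  \<comment> \<open>The last two cases are exhaustive for a \<open>v\<close> free in neither
    conjunct, since it is quantified in at most one of them; the top found in the other side is then
    kept, shifted by one direction.\<close>
  consider "v \<in> free a F" "v \<in> free a G" | "v \<in> free a F" "v \<notin> set (quantified_vars G)" "v \<notin> free a G"
    | "v \<in> free a G" "v \<notin> set (quantified_vars F)" "v \<notin> free a F"
    | "v \<notin> free a F" "v \<notin> free a G" "v \<notin> set (quantified_vars F)"
    | "v \<notin> free a F" "v \<notin> free a G" "v \<notin> set (quantified_vars G)"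
    using st by blast
  then show ?case
  proof cases
    case 1
    then have "s\<^sub>1 = []" "s\<^sub>2 = []"
      using root[OF _ s1] root[OF _ s2] by auto
    then show ?thesis
      using 1 s1 s2 by (intro exI[of _ "[]"]) auto
  next
    case 2
    then have "s\<^sub>1 = []"
      using root[OF _ s1] by auto
    then show ?thesis
      using 2 s1 only[of G] by (intro exI[of _ "[]"]) auto
  next
    case 3
    then have "s\<^sub>2 = []"
      using root[OF _ s2] by auto
    then show ?thesis
      using 3 s2 only[of F] by (intro exI[of _ "[]"]) auto
  next
    case 4
    then show ?thesis
      using s2 only[of F] by (intro exI[of _ "True # s\<^sub>2"]) auto
  next
    case 5
    then show ?thesis
      using s1 only[of G] by (intro exI[of _ "False # s\<^sub>1"]) auto
  qed
next
  case (Qu Q x F)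
  note st = standardized_Qu[OF Qu.prems]
  obtain s where s: "\<forall>q\<in>positions F. v \<in> free_at a F q \<longrightarrow> q = s \<or> q \<noteq> [] \<and> v \<in> free_at a F (butlast q)"
    using Qu.IH st by blast
  show ?case
  proof (cases "v \<in> free a F \<and> v \<noteq> x")
    case True
    then have "s = []"
      using s by (metis Nil_position free_at_Nil)
    then show ?thesis
      using True s by (intro exI[of _ "[]"]) auto
  next
    \<comment> \<open>Here the new root does not carry \<open>v\<close>, so the old top remains the
      top, one level further down.\<close>
    case False
    then show ?thesis
      using s by (intro exI[of _ "False # s"]) auto
  qed
qed simp

lemma holes_subformula: "\<theta> \<in> subformulas \<psi> \<Longrightarrow> holes \<theta> \<subseteq> holes \<psi>"
  by (induction \<psi>) (auto simp: holes_def)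

lemma hole_subformula: "i \<in> holes \<psi> \<Longrightarrow> Hole i \<in> subformulas \<psi>"
  by (induction \<psi>) (auto simp: holes_def)

lemma syntax_tree_decomposition:
  assumes "standardized a \<psi>"
  shows "\<exists>D. tree_decomposition (hypergraph_of \<psi> a) D \<and> bagsize D = width a \<psi>"
proof -
  let ?P = "positions \<psi>"
  \<comment> \<open>Nodes of a \<open>tree_decomp\<close> are natural numbers, so positions are
    numbered by an injection, with \<open>g\<close> reading the position back.\<close>
  obtain f :: "bool list \<Rightarrow> nat" where inj: "inj_on f ?P"
    using finite_imp_inj_to_nat_seg[OF finite_positions] by blast
  define g where "g = inv_into ?P f"
  have g [simp]: "q \<in> ?P \<Longrightarrow> g (f q) = q" for q
    using inj unfolding g_def by simp
  let ?V = "f ` ?P" and ?r = "f []" and ?p = "\<lambda>t. f (butlast (g t))"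
  let ?E = "(\<lambda>t. {t, ?p t}) ` (?V - {?r})" and ?B = "\<lambda>t. free_at a \<psi> (g t)"
  let ?d = "\<lambda>t. length (g t)"
  define D where "D = \<lparr>nodes = ?V, tedges = ?E, bag = ?B\<rparr>"
  have D [simp]: "nodes D = ?V" "tedges D = ?E" "bag D = ?B"
    by (simp_all add: D_def)
  have par: "?p t \<in> ?V \<and> ?d (?p t) < ?d t" if "t \<in> ?V - {?r}" for t
  proof -
    obtain q where q: "q \<in> ?P" "t = f q" "q \<noteq> []"
      using \<open>t \<in> ?V - {?r}\<close> by auto
    then show ?thesis
      using butlast_position[OF q(1)] by simp
  qed
  have "tree_graph ?V ?E"
    by (rule tree_graph_rooted[of _ _ _ ?d]) (use par finite_positions in auto)
  moreover have img: "?B ` ?V = free a ` subformulas \<psi>"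
    using free_at_image[of a \<psi>] by (simp add: image_image)
  moreover have "?B t \<subseteq> hverts (hypergraph_of \<psi> a)" if "t \<in> ?V" for t
  proof -
    obtain \<theta> where \<theta>: "\<theta> \<in> subformulas \<psi>" "?B t = free a \<theta>"
      using img \<open>t \<in> ?V\<close> by (metis (no_types, lifting) imageE imageI)
    then show ?thesis
      using free_subset_holes[of a \<theta>] holes_subformula[OF \<theta>(1)]
      by (simp add: hypergraph_of_def) blast
  qed
  moreover have in_bag: "\<exists>t\<in>?V. free a \<theta> = ?B t" if "\<theta> \<in> subformulas \<psi>" for \<theta>
    using img that by (metis (no_types, lifting) imageE imageI)
  moreover have "\<exists>t\<in>?V. v \<in> ?B t" if v: "v \<in> hverts (hypergraph_of \<psi> a)" for v
  proof -
    obtain i where "i \<in> holes \<psi>" "v \<in> the (a i)"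
      using v by (auto simp: hypergraph_of_def)
    then show ?thesis
      using in_bag[OF hole_subformula] by fastforce
  qed
  moreover have "\<exists>t\<in>?V. e \<subseteq> ?B t" if e: "e \<in> hedges (hypergraph_of \<psi> a)" for e
  proof -
    consider i where "i \<in> holes \<psi>" "e = the (a i)" | "e = free a \<psi>"
      using e by (auto simp: hypergraph_of_def)
    then show ?thesis
    proof cases
      case 1
      then show ?thesis
        using in_bag[OF hole_subformula[OF 1(1)]] by auto
    next
      case 2
      then show ?thesis
        using in_bag[OF self_subformula] by auto
    qed
  qed
  moreover have "connected_in ?E {t \<in> ?V. v \<in> ?B t}" for v
  proof -
    obtain s where s: "\<forall>q\<in>?P. v \<in> free_at a \<psi> q \<longrightarrow> q = s \<or> q \<noteq> [] \<and> v \<in> free_at a \<psi> (butlast q)"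
      using free_at_top[OF assms] by blast
    show ?thesis
    proof (rule connected_in_rooted[of _ "f s" ?p _ ?d])
      fix t
      assume t: "t \<in> {t \<in> ?V. v \<in> ?B t}" "t \<noteq> f s"
      then obtain q where q: "q \<in> ?P" "t = f q" "v \<in> free_at a \<psi> q"
        by auto
      then have "q \<noteq> s"
        using t(2) by blast
      then have "q \<noteq> []" "v \<in> free_at a \<psi> (butlast q)"
        using s q by auto
      moreover from this have "t \<noteq> ?r"
        using q inj_onD[OF inj, of q "[]"] by auto
      ultimately show "?p t \<in> {t \<in> ?V. v \<in> ?B t} \<and> {t, ?p t} \<in> ?E \<and> ?d (?p t) < ?d t"
        using q butlast_position[OF q(1)] par[of t] by auto
    qed
  qed
  ultimately have "tree_decomposition (hypergraph_of \<psi> a) D"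
    unfolding tree_decomposition_def by auto
  moreover have "bagsize D = width a \<psi>"
  proof -
    have "(\<lambda>t. card (?B t)) ` ?V = card ` (free a ` subformulas \<psi>)"
      unfolding img[symmetric] by (simp add: image_image)
    then show ?thesis
      unfolding bagsize_def width_def by (simp add: image_image)
  qed
  ultimately show ?thesis
    by blast
qed

section \<open>Rooting a tree\<close>

text \<open>A walk is kept free of repetitions by cutting it back to the earlier visit whenever the
  next vertex has been seen before.\<close>

lemma path_list:
  assumes "(\<lambda>x y. {x, y} \<in> E)\<^sup>*\<^sup>* u v"
  shows "\<exists>vs. vs \<noteq> [] \<and> distinct vs \<and> hd vs = u \<and> last vs = v \<and>
    (\<forall>i. Suc i < length vs \<longrightarrow> {vs ! i, vs ! Suc i} \<in> E)"
  using assms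
proof (induction rule: rtranclp_induct)
  case base
  show ?case
    by (intro exI[of _ "[u]"]) auto
next
  case (step y z)
  then obtain vs where vs: "vs \<noteq> []" "distinct vs" "hd vs = u" "last vs = y"
    "\<forall>i. Suc i < length vs \<longrightarrow> {vs ! i, vs ! Suc i} \<in> E"
    by blast
  show ?case
  proof (cases "z \<in> set vs")
    case True
    then obtain j where j: "j < length vs" "vs ! j = z"
      by (metis in_set_conv_nth)
    then have "last (take (Suc j) vs) = z"
      by (simp add: take_Suc_conv_app_nth)
    then show ?thesis
      using vs j by (intro exI[of _ "take (Suc j) vs"]) auto
  next
    case False
    have "{(vs @ [z]) ! i, (vs @ [z]) ! Suc i} \<in> E" if "Suc i < length (vs @ [z])" for i
    proof (cases "Suc i < length vs")
      case True
      then show ?thesis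
        using vs(5) by (simp add: nth_append)
    next
      case False
      then have "i = length vs - 1"
        using that by auto
      then show ?thesis
        using step(2) vs(1,4) by (simp add: nth_append last_conv_nth)
    qed
    then show ?thesis
      using vs False by (intro exI[of _ "vs @ [z]"]) auto
  qed
qed

text \<open>The edge closes a path between its ends that avoids it. Such a path has at least three
  vertices, because with two its only step would be the deleted edge.\<close>

lemma bridge_cycle:
  assumes "{u, v} \<in> E" "u \<noteq> v" "(\<lambda>x y. {x, y} \<in> E - {{u, v}})\<^sup>*\<^sup>* u v"
  shows "\<exists>vs. cycle_in E vs"
proof -
  obtain vs where vs: "vs \<noteq> []" "distinct vs" "hd vs = u" "last vs = v"
    and ed: "\<And>i. Suc i < length vs \<Longrightarrow> {vs ! i, vs ! Suc i} \<in> E - {{u, v}}"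
    using path_list[OF assms(3)] by blast
  have first: "vs ! 0 = u" and last: "vs ! (length vs - 1) = v"
    using vs by (auto simp: hd_conv_nth last_conv_nth)
  have "length vs \<noteq> 1"
    using first last assms(2) by auto
  moreover have "length vs \<noteq> 2"
    using first last ed[of 0] by auto
  moreover have "length vs \<noteq> 0"
    using vs by simp
  ultimately have len: "3 \<le> length vs"
    by linarith
  have "{vs ! i, vs ! (Suc i mod length vs)} \<in> E" if "i < length vs" for i
  proof (cases "Suc i < length vs")
    case True
    then show ?thesis
      using ed by simp
  next
    case False
    then have "Suc i = length vs"
      using that by simp
    moreover from this have "i = length vs - 1"
      by simp
    ultimately show ?thesis
      using first last assms(1) by (simp add: insert_commute)
  qed
  then show ?thesis
    using len vs unfolding cycle_in_def by blast
qed

text \<open>\<open>p\<close> is the parent function and \<open>d\<close> a depth. The equation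
  \<open>d r = 0\<close> later makes a variable of the root bag at most as deep as any
  other.\<close>

definition rooted :: "nat set \<Rightarrow> nat set set \<Rightarrow> nat \<Rightarrow> (nat \<Rightarrow> nat) \<Rightarrow> (nat \<Rightarrow> nat) \<Rightarrow> bool" where
  "rooted V E r p d \<longleftrightarrow> d r = 0 \<and> (\<forall>t\<in>V - {r}. d (p t) < d t) \<and> E \<subseteq> (\<lambda>t. {t, p t}) ` (V - {r})"

text \<open>\<open>d\<close> is the distance from \<open>r\<close> and \<open>p\<close> picks a
  predecessor closer to \<open>r\<close>. Acyclicity then leaves no edge other than those to
  parents: an additional one would close a cycle with the parent paths of its ends.\<close>

lemma tree_graph_rootedE:
  assumes "tree_graph V E" "r \<in> V"
  obtains p d where "rooted V E r p d"
proof -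
  let ?R = "\<lambda>x y. x \<in> V \<and> y \<in> V \<and> {x, y} \<in> E"
  define d where "d t = (LEAST n. (?R ^^ n) r t)" for t
  have dist: "(?R ^^ d t) r t" if "t \<in> V" for t
  proof -
    have "?R\<^sup>*\<^sup>* r t"
      using assms that unfolding tree_graph_def connected_in_def by blast
    then show ?thesis
      unfolding d_def rtranclp_power by (rule LeastI_ex)
  qed
  have "\<exists>s. ?R s t \<and> d s < d t" if t: "t \<in> V - {r}" for t
  proof -
    obtain m where m: "d t = Suc m"
      using dist[of t] t by (cases "d t") auto
    then obtain s where s: "(?R ^^ m) r s" "?R s t"
      using dist[of t] t by auto
    then have "d s \<le> m"
      unfolding d_def by (intro Least_le)
    then show ?thesis
      using s m by auto
  qed
  then obtain p where p: "\<And>t. t \<in> V - {r} \<Longrightarrow> ?R (p t) t \<and> d (p t) < d t"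
    by metis
  have "E \<subseteq> (\<lambda>t. {t, p t}) ` (V - {r})"
  proof
    fix e
    assume e: "e \<in> E"
    then have "e \<subseteq> V" "card e = 2"
      using assms unfolding tree_graph_def by auto
    then obtain u v where uv: "e = {u, v}" "u \<noteq> v" "u \<in> V" "v \<in> V"
      by (auto simp: card_2_iff)
    show "e \<in> (\<lambda>t. {t, p t}) ` (V - {r})"
    proof (rule ccontr)
      assume no: "e \<notin> (\<lambda>t. {t, p t}) ` (V - {r})"
      \<comment> \<open>The graph without the doubtful edge. It still contains all parent edges, so
        the two ends remain connected through the root.\<close>
      let ?T = "\<lambda>x y. {x, y} \<in> E - {{u, v}}"
      have up: "?T\<^sup>*\<^sup>* t r" if "t \<in> V" for t
        using that
      proof (induction "d t" arbitrary: t rule: less_induct)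
        case less
        show ?case
        proof (cases "t = r")
          case False
          then have t: "?R (p t) t" "d (p t) < d t"
            using p less by auto
          then have "{t, p t} \<in> E"
            by (simp add: insert_commute)
          moreover have "{t, p t} \<noteq> {u, v}"
            using no uv False less by blast
          ultimately show ?thesis
            using less t by (intro converse_rtranclp_into_rtranclp[of ?T t "p t" r]) auto
        qed simp
      qed
      have "symp ?T\<^sup>*\<^sup>*"
        by (intro symp_rtranclp) (auto simp: symp_def insert_commute)
      then have "?T\<^sup>*\<^sup>* u v"
        using up[OF uv(3)] up[OF uv(4)] by (meson rtranclp_trans sympD)
      then have "\<exists>vs. cycle_in E vs"
        using bridge_cycle uv e by metis
      then show False
        using assms unfolding tree_graph_def by blast
    qed
  qed
  moreover have "d r = 0"
    unfolding d_def by (intro Least_eq_0) simp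
  ultimately show thesis
    using that p unfolding rooted_def by blast
qed

lemma rtranclp_exit:
  assumes "R\<^sup>*\<^sup>* x y" "P x" "\<not> P y"
  shows "\<exists>u v. P u \<and> \<not> P v \<and> R u v"
  using assms by (induction rule: rtranclp_induct) auto

text \<open>The shallowest vertex \<open>s\<close> of \<open>S\<close> is no descendant of another
  vertex \<open>t\<close> of \<open>S\<close>. A walk in \<open>S\<close> from \<open>t\<close> to
  \<open>s\<close> must thus leave the descendants of \<open>t\<close>, and the only exit is the
  edge from \<open>t\<close> to its parent.\<close>

lemma rooted_connected_top:
  assumes "rooted V E r p d" "S \<noteq> {}" "connected_in E S"
  shows "\<exists>s\<in>S. \<forall>t\<in>S - {s}. t \<noteq> r \<and> p t \<in> S \<and> d s < d t"
proof -
  obtain s where s: "s \<in> S" "\<And>t. t \<in> S \<Longrightarrow> d s \<le> d t"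
    using exists_least_iff[of "\<lambda>n. \<exists>t\<in>S. d t = n"] assms(2) by (metis ex_in_conv not_less)
  have "t \<noteq> r \<and> p t \<in> S \<and> d s < d t" if t: "t \<in> S" "t \<noteq> s" for t
  proof -
    \<comment> \<open>\<open>?up\<^sup>*\<^sup>* x t\<close> says that \<open>x\<close> is a
      descendant of \<open>t\<close>, possibly \<open>t\<close> itself.\<close>
    let ?up = "\<lambda>x y. x \<in> V - {r} \<and> y = p x"
    have desc: "x = t \<or> d t < d x" if "?up\<^sup>*\<^sup>* x t" for x
      using that
    proof (induction rule: converse_rtranclp_induct)
      case (step x z)
      then have "d z < d x"
        using assms(1) unfolding rooted_def by blast
      then show ?case
        using step.IH by auto
    qed simp
    then have "\<not> ?up\<^sup>*\<^sup>* s t"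
      using desc[of s] t s(2)[OF t(1)] leD by blast
    moreover have "(\<lambda>x y. x \<in> S \<and> y \<in> S \<and> {x, y} \<in> E)\<^sup>*\<^sup>* t s"
      using assms(3) s t unfolding connected_in_def by blast
    ultimately obtain x y where xy: "?up\<^sup>*\<^sup>* x t" "\<not> ?up\<^sup>*\<^sup>* y t" "x \<in> S" "y \<in> S" "{x, y} \<in> E"
      using rtranclp_exit[of _ t s "\<lambda>x. ?up\<^sup>*\<^sup>* x t"] by blast
    obtain z where z: "z \<in> V - {r}" "{x, y} = {z, p z}"
      using assms(1) xy(5) unfolding rooted_def by blast
    have "z \<noteq> y"
    proof
      assume "z = y"
      then have "?up y x"
        using z by (auto simp: doubleton_eq_iff)
      then show False
        using xy(1,2) converse_rtranclp_into_rtranclp[of ?up y x t] by blast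
    qed
    then have zx: "z = x" "y = p x"
      using z(2) by (auto simp: doubleton_eq_iff)
    \<comment> \<open>The parent of a proper descendant of \<open>t\<close> is again a descendant,
      so the walk can only leave at \<open>t\<close>.\<close>
    have "x = t"
      using xy(1,2) zx(2) by (cases rule: converse_rtranclpE) auto
    then have "t \<noteq> r" "p t \<in> S" "d (p t) < d t"
      using zx z(1) xy(4) assms(1) unfolding rooted_def by auto
    then show ?thesis
      using s(2)[of "p t"] by auto
  qed
  then show ?thesis
    using s(1) by blast
qed

section \<open>Existence of a simplicial variable\<close>

text \<open>A quantified variable whose topmost bag is as deep as possible is simplicial: its
  topmost bag contains all other remaining variables that share a bag with it.\<close>

lemma simplicial_variable:
  assumes "tree_decomposition H D" "e \<in> hedges H" "hverts H \<subseteq> e \<union> Q" "finite Q"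
    and "Q' \<subseteq> Q" "Q' \<noteq> {}"
  shows "\<exists>x\<in>Q'. \<exists>t\<in>nodes D. \<forall>t'\<in>nodes D. x \<in> bag D t' \<longrightarrow> bag D t' - (Q - Q') \<subseteq> bag D t"
proof -
  let ?S = "\<lambda>v. {t \<in> nodes D. v \<in> bag D t}"
  have tree: "tree_graph (nodes D) (tedges D)"
    and sub: "\<And>t. t \<in> nodes D \<Longrightarrow> bag D t \<subseteq> hverts H"
    and cov: "\<And>v. v \<in> hverts H \<Longrightarrow> ?S v \<noteq> {}"
    and conn: "\<And>v. v \<in> hverts H \<Longrightarrow> connected_in (tedges D) (?S v)"
    using assms(1) unfolding tree_decomposition_def by auto
  obtain r where r: "r \<in> nodes D" "e \<subseteq> bag D r"
    using assms(1,2) unfolding tree_decomposition_def by auto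
  obtain p d where rt: "rooted (nodes D) (tedges D) r p d"
    using tree_graph_rootedE[OF tree r(1)] .
  have "\<forall>v\<in>hverts H. \<exists>s. s \<in> ?S v \<and> (\<forall>t\<in>?S v - {s}. t \<noteq> r \<and> p t \<in> ?S v \<and> d s < d t)"
    using rooted_connected_top[OF rt cov conn] by blast
  from bchoice[OF this] obtain top where "\<forall>v\<in>hverts H. top v \<in> ?S v \<and>
      (\<forall>t\<in>?S v - {top v}. t \<noteq> r \<and> p t \<in> ?S v \<and> d (top v) < d t)"
    by blast
  then have top: "\<And>v. v \<in> hverts H \<Longrightarrow> top v \<in> ?S v"
    and par: "\<And>v t. v \<in> hverts H \<Longrightarrow> t \<in> ?S v \<Longrightarrow> t \<noteq> top v \<Longrightarrow>
      t \<noteq> r \<and> p t \<in> ?S v \<and> d (top v) < d t"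
    by blast+
  show ?thesis
  proof (cases "Q' \<subseteq> hverts H")
    \<comment> \<open>A variable outside \<open>H\<close> lies in no bag, so every node is a
      witness.\<close>
    case False
    then show ?thesis
      using r(1) sub by blast
  next
    case True
    have fin: "finite ((\<lambda>v. d (top v)) ` Q')"
      using assms(4,5) finite_subset by blast
    have "Max ((\<lambda>v. d (top v)) ` Q') \<in> (\<lambda>v. d (top v)) ` Q'"
      using assms(6) by (intro Max_in[OF fin]) simp
    then obtain x where x: "x \<in> Q'" "d (top x) = Max ((\<lambda>v. d (top v)) ` Q')"
      by force
    have max: "d (top y) \<le> d (top x)" if "y \<in> Q'" for y
      using fin that x(2) by simp
    have xH: "x \<in> hverts H"
      using x True by blast
    have "bag D t - (Q - Q') \<subseteq> bag D (top x)" if t: "t \<in> nodes D" "x \<in> bag D t" for t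
    proof
      fix y
      assume y: "y \<in> bag D t - (Q - Q')"
      then have yH: "y \<in> hverts H"
        using sub t by blast
      \<comment> \<open>If \<open>y\<close> is not in \<open>Q'\<close> it is not in
        \<open>Q\<close> either, hence lies in \<open>e\<close> and in the root bag, and its top has
        depth 0.\<close>
      have le: "d (top y) \<le> d (top x)"
      proof (cases "y \<in> Q'")
        case False
        then have "r \<in> ?S y"
          using y yH assms(3) r by blast
        then have "top y = r"
          using par[OF yH] by blast
        then show ?thesis
          using rt unfolding rooted_def by simp
      qed (rule max)
      have "y \<in> bag D t"
        using y by blast
      \<comment> \<open>Climb from \<open>t\<close> towards \<open>top x\<close>. Until that node is
        reached, the current one is strictly deeper than both tops, so \<open>x\<close> and
        \<open>y\<close> both persist in the bag of the parent.\<close>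
      with t show "y \<in> bag D (top x)"
      proof (induction "d t" arbitrary: t rule: less_induct)
        case less
        show ?case
        proof (cases "t = top x")
          case False
          then have px: "t \<noteq> r" "p t \<in> ?S x" "d (top x) < d t"
            using par[OF xH, of t] less.prems by auto
          then have "t \<noteq> top y"
            using le by auto
          then have "p t \<in> ?S y"
            using par[OF yH, of t] less.prems by auto
          moreover have "d (p t) < d t"
            using rt px(1) less.prems unfolding rooted_def by blast
          ultimately show ?thesis
            using less.hyps[of "p t"] px(2) by blast
        qed (use less.prems in simp)
      qed
    qed
    then show ?thesis
      using x(1) top[OF xH] by blast
  qed
qed

section \<open>Variable elimination\<close>

text \<open>An item is a formula together with a list of its free variables.\<close>

type_synonym item = "hform \<times> nat list"

text \<open>The witness \<open>B\<close> is an argument so that all bags can be tried. A variable in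
  no bag passes with any \<open>B\<close>, so vacuous quantifiers need no separate selection
  rule.\<close>

definition simplicial :: "nat \<Rightarrow> nat list \<Rightarrow> nat list list \<Rightarrow> bool" where
  "simplicial x B bags \<longleftrightarrow> (\<forall>B'\<in>set bags. x \<in> set B' \<longrightarrow> set B' \<subseteq> set B)"

text \<open>The default 0 is not reached while \<open>eliminable\<close> holds and variables remain.
  Its code \<open>Leaf\<close> is what the program returns for the empty list.\<close>

fun pick :: "nat list \<Rightarrow> nat list list \<Rightarrow> nat" where
  "pick [] bags = 0"
| "pick (q # qs) bags = (if \<exists>B\<in>set bags. simplicial q B bags then q else pick qs bags)"

fun conj_items :: "item list \<Rightarrow> item" where
  "conj_items [] = (Hole 0, [])"
| "conj_items [I] = I"
| "conj_items (I # J # Is) =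
    (let K = conj_items (J # Is) in (Bin Conj (fst I) (fst K), snd I @ snd K))"

text \<open>\<open>removeAll\<close> is needed because merged items list a shared variable several
  times.\<close>

definition quantify :: "nat \<Rightarrow> item \<Rightarrow> item" where
  "quantify x I = (Qu Exists x (fst I), removeAll x (snd I))"

text \<open>If \<open>x\<close> is free in no item then it is quantified, vacuously, in front of the first one.\<close>

definition eliminate :: "nat \<Rightarrow> item list \<Rightarrow> item list" where
  "eliminate x Is = (case filter (\<lambda>I. x \<in> set (snd I)) Is of
     [] \<Rightarrow> (case Is of [] \<Rightarrow> [] | I # Is' \<Rightarrow> quantify x I # Is')
   | J # Js \<Rightarrow> quantify x (conj_items (J # Js)) # filter (\<lambda>I. x \<notin> set (snd I)) Is)"

text \<open>The recursion runs on a counter because \<open>pick\<close> may take any element of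
  \<open>qs\<close>, not just its head.\<close>

primrec solve :: "nat \<Rightarrow> nat list \<Rightarrow> item list \<Rightarrow> nat list list \<Rightarrow> hform" where
  "solve 0 qs Is bags = fst (conj_items Is)"
| "solve (Suc n) qs Is bags = (let x = pick qs bags in
     solve n (removeAll x qs) (eliminate x Is) (map (removeAll x) bags))"

abbreviation item_holes :: "item list \<Rightarrow> nat list" where
  "item_holes Is \<equiv> concat (map (\<lambda>I. hole_list (fst I)) Is)"

abbreviation item_quants :: "item list \<Rightarrow> nat list" where
  "item_quants Is \<equiv> concat (map (\<lambda>I. quantified_vars (fst I)) Is)"

abbreviation item_vars :: "item list \<Rightarrow> nat set" where
  "item_vars Is \<equiv> (\<Union>I\<in>set Is. set (snd I))"

definition item_ok :: "assoc \<Rightarrow> nat \<Rightarrow> item \<Rightarrow> bool" where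
  "item_ok a k I \<longleftrightarrow> ex_and_formula (fst I) \<and> free a (fst I) = set (snd I) \<and> width a (fst I) \<le> k"

section \<open>Correctness of the elimination\<close>

text \<open>Every partial conjunction has its free variables among those of the full one, so a bound
  on the full union bounds the width of all new subformulas.\<close>

lemma conj_items_correct:
  assumes "Is \<noteq> []" "\<And>I. I \<in> set Is \<Longrightarrow> item_ok a k I" "card (item_vars Is) \<le> k"
  shows "hole_list (fst (conj_items Is)) = item_holes Is"
    "quantified_vars (fst (conj_items Is)) = item_quants Is"
    "set (snd (conj_items Is)) = item_vars Is"
    "item_ok a k (conj_items Is)"
proof -
  have "hole_list (fst (conj_items Is)) = item_holes Is \<and>
    quantified_vars (fst (conj_items Is)) = item_quants Is \<and>
    set (snd (conj_items Is)) = item_vars Is \<and> item_ok a k (conj_items Is)"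
    using assms
  proof (induction Is rule: conj_items.induct)
    case (3 I J Is)
    have "card (item_vars (J # Is)) \<le> card (item_vars (I # J # Is))"
      by (rule card_mono) auto
    then have IH: "hole_list (fst (conj_items (J # Is))) = item_holes (J # Is)"
      "quantified_vars (fst (conj_items (J # Is))) = item_quants (J # Is)"
      "set (snd (conj_items (J # Is))) = item_vars (J # Is)" "item_ok a k (conj_items (J # Is))"
      using 3 by auto
    have "item_ok a k I"
      using "3.prems" by simp
    then show ?case
      using IH "3.prems"(3) by (simp add: item_ok_def width_le_iff Let_def ball_Un)
  qed (auto simp: item_ok_def)
  then show "hole_list (fst (conj_items Is)) = item_holes Is"
    "quantified_vars (fst (conj_items Is)) = item_quants Is"
    "set (snd (conj_items Is)) = item_vars Is"
    "item_ok a k (conj_items Is)"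
    by auto
qed

lemma quantify_ok:
  assumes "item_ok a k I"
  shows "item_ok a k (quantify x I)"
proof -
  have "card (free a (fst I)) \<le> k"
    using assms self_subformula unfolding item_ok_def width_le_iff by blast
  moreover have "card (free a (fst I) - {x}) \<le> card (free a (fst I))"
    using assms unfolding item_ok_def by (intro card_mono) auto
  ultimately show ?thesis
    using assms unfolding item_ok_def quantify_def width_le_iff by auto
qed

text \<open>A common form for the vacuous and the proper case: \<open>Js\<close> is merged and
  quantified, \<open>Ks\<close> is left alone. The final alternative is what puts the variables of
  \<open>Js\<close> into one bag.\<close>

lemma eliminate_cases:
  assumes "Is \<noteq> []"
  obtains Js Ks where "Js \<noteq> []" "mset Is = mset Js + mset Ks"
    "eliminate x Is = quantify x (conj_items Js) # Ks" "\<And>K. K \<in> set Ks \<Longrightarrow> x \<notin> set (snd K)"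
    "(\<exists>J. Js = [J]) \<or> (\<forall>J\<in>set Js. x \<in> set (snd J))"
proof (cases "filter (\<lambda>I. x \<in> set (snd I)) Is")
  case Nil
  obtain I Is' where I: "Is = I # Is'"
    using assms by (cases Is) auto
  then have "\<And>K. K \<in> set Is' \<Longrightarrow> x \<notin> set (snd K)"
    using Nil by (auto simp: filter_empty_conv split: if_splits)
  then show thesis
    using that[of "[I]" Is'] Nil I by (simp add: eliminate_def)
next
  case (Cons J Js)
  show thesis
  proof (rule that[of "J # Js" "filter (\<lambda>I. x \<notin> set (snd I)) Is"])
    show "mset Is = mset (J # Js) + mset (filter (\<lambda>I. x \<notin> set (snd I)) Is)"
      unfolding Cons[symmetric] by (simp add: multiset_partition)
    have "set (J # Js) = set (filter (\<lambda>I. x \<in> set (snd I)) Is)"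
      unfolding Cons ..
    then show "(\<exists>J'. J # Js = [J']) \<or> (\<forall>J\<in>set (J # Js). x \<in> set (snd J))"
      by auto
  qed (auto simp: eliminate_def Cons)
qed

text \<open>\<open>Q\<close> stands for the variables that remain after the others have been
  deleted. Asking for a simplicial one for every \<open>Q\<close> makes the property hereditary,
  with no reference to a tree.\<close>

definition eliminable :: "nat list \<Rightarrow> nat list list \<Rightarrow> bool" where
  "eliminable qs bags \<longleftrightarrow> (\<forall>Q\<subseteq>set qs. Q \<noteq> {} \<longrightarrow>
     (\<exists>x\<in>Q. \<exists>B\<in>set bags. \<forall>B'\<in>set bags. x \<in> set B' \<longrightarrow> set B' - (set qs - Q) \<subseteq> set B))"

lemma pick_simplicial:
  assumes "eliminable qs bags" "qs \<noteq> []"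
  shows "pick qs bags \<in> set qs \<and> (\<exists>B\<in>set bags. simplicial (pick qs bags) B bags)"
proof -
  have "\<exists>q\<in>set qs. \<exists>B\<in>set bags. simplicial q B bags"
    using assms unfolding eliminable_def simplicial_def by (auto dest!: spec[of _ "set qs"])
  then show ?thesis
    by (induction qs) auto
qed

text \<open>The witness for the same \<open>Q\<close> before the deletion still works:
  \<open>x\<close> is not in \<open>Q\<close>, so it was already among the discounted
  variables.\<close>

lemma eliminable_remove:
  assumes "eliminable qs bags" "x \<in> set qs"
  shows "eliminable (removeAll x qs) (map (removeAll x) bags)"
  unfolding eliminable_def
proof (intro allI impI)
  fix Q
  assume Q: "Q \<subseteq> set (removeAll x qs)" "Q \<noteq> {}"
  then have "Q \<subseteq> set qs"
    by auto
  from assms(1)[unfolded eliminable_def, rule_format, OF this Q(2)]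
  obtain y B where y: "y \<in> Q" "B \<in> set bags"
    and sub: "\<forall>B'\<in>set bags. y \<in> set B' \<longrightarrow> set B' - (set qs - Q) \<subseteq> set B"
    by blast
  have "set (removeAll x B') - (set (removeAll x qs) - Q) \<subseteq> set (removeAll x B)"
    if "B' \<in> set bags" "y \<in> set (removeAll x B')" for B'
    using sub[rule_format, OF that(1)] that(2) Q(1) by auto
  then show "\<exists>y\<in>Q. \<exists>B\<in>set (map (removeAll x) bags). \<forall>B'\<in>set (map (removeAll x) bags).
      y \<in> set B' \<longrightarrow> set B' - (set (removeAll x qs) - Q) \<subseteq> set B"
    using y by auto
qed

text \<open>\<open>W\<close> is meant to be \<open>free a \<phi>\<close> and \<open>k\<close> the
  bag size. That each item fits into a bag is what bounds a merger; \<open>card W \<le> k\<close>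
  bounds the last conjunction.\<close>

definition solver_invariant ::
  "assoc \<Rightarrow> nat \<Rightarrow> nat set \<Rightarrow> nat list \<Rightarrow> item list \<Rightarrow> nat list list \<Rightarrow> bool" where
  "solver_invariant a k W qs Is bags \<longleftrightarrow> Is \<noteq> [] \<and> distinct (item_quants Is @ qs) \<and>
     (\<forall>I\<in>set Is. item_ok a k I) \<and> set (item_quants Is) \<inter> item_vars Is = {} \<and>
     item_vars Is \<subseteq> W \<union> set qs \<and> finite W \<and> card W \<le> k \<and>
     (\<forall>I\<in>set Is. \<exists>B\<in>set bags. set (snd I) \<subseteq> set B) \<and> (\<forall>B\<in>set bags. card (set B) \<le> k) \<and>
     eliminable qs bags"

lemma solver_step:
  assumes "solver_invariant a k W qs Is bags" "qs \<noteq> []"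
  defines "x \<equiv> pick qs bags"
  shows "x \<in> set qs"
    "solver_invariant a k W (removeAll x qs) (eliminate x Is) (map (removeAll x) bags)"
    "mset (item_holes (eliminate x Is)) = mset (item_holes Is)"
    "mset (item_quants (eliminate x Is)) = mset (item_quants Is) + {#x#}"
proof -
  have "Is \<noteq> []" and dist: "distinct (item_quants Is @ qs)"
    and ok: "\<And>I. I \<in> set Is \<Longrightarrow> item_ok a k I"
    and disj: "set (item_quants Is) \<inter> item_vars Is = {}"
    and W: "item_vars Is \<subseteq> W \<union> set qs" "finite W" "card W \<le> k"
    and inbag: "\<And>I. I \<in> set Is \<Longrightarrow> \<exists>B\<in>set bags. set (snd I) \<subseteq> set B"
    and card: "\<And>B. B \<in> set bags \<Longrightarrow> card (set B) \<le> k"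
    and elim: "eliminable qs bags"
    using assms(1) unfolding solver_invariant_def by auto
  obtain B where x: "x \<in> set qs" and B: "B \<in> set bags" "simplicial x B bags"
    using pick_simplicial[OF elim assms(2)] unfolding x_def by blast
  obtain Js Ks where Js: "Js \<noteq> []" "mset Is = mset Js + mset Ks"
    and el: "eliminate x Is = quantify x (conj_items Js) # Ks"
    and Ks: "\<And>K. K \<in> set Ks \<Longrightarrow> x \<notin> set (snd K)"
    and or: "(\<exists>J. Js = [J]) \<or> (\<forall>J\<in>set Js. x \<in> set (snd J))"
    using eliminate_cases[OF \<open>Is \<noteq> []\<close>, of x] by metis
  have setIs: "set Is = set Js \<union> set Ks"
    using Js(2) by (metis set_mset_mset set_mset_union)
  have concat_mset: "mset (concat (map f Is)) = mset (concat (map f Js)) + mset (concat (map f Ks))"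
    for f :: "item \<Rightarrow> nat list"
  proof -
    have "mset (concat (map f Is)) = \<Sum>\<^sub># (image_mset (\<lambda>I. mset (f I)) (mset Is))" for Is
      by (induction Is) auto
    then show ?thesis
      using Js(2) by simp
  qed
  \<comment> \<open>A single item fits into its own bag. Several merged items all contain
    \<open>x\<close>, so the simplicial bag \<open>B\<close> contains the bag of each.\<close>
  obtain C where C: "C \<in> set bags" "item_vars Js \<subseteq> set C"
  proof (cases "\<exists>J. Js = [J]")
    case True
    then obtain J where "Js = [J]" "\<exists>B\<in>set bags. set (snd J) \<subseteq> set B"
      using inbag setIs by auto
    then show thesis
      using that by auto
  next
    case False
    have "set (snd J) \<subseteq> set B" if "J \<in> set Js" for J
    proof -
      have "x \<in> set (snd J)"
        using False or that by blast
      moreover obtain B' where "B' \<in> set bags" "set (snd J) \<subseteq> set B'"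
        using inbag[of J] \<open>J \<in> set Js\<close> setIs by auto
      ultimately show ?thesis
        using B(2) unfolding simplicial_def by blast
    qed
    then show thesis
      using that[OF B(1)] by blast
  qed
  let ?K = "conj_items Js"
  have "card (item_vars Js) \<le> card (set C)"
    using C(2) by (intro card_mono) auto
  then have "card (item_vars Js) \<le> k"
    using card[OF C(1)] by simp
  note K = conj_items_correct[of Js a k, OF Js(1) ok this]
  have K: "hole_list (fst ?K) = item_holes Js" "quantified_vars (fst ?K) = item_quants Js"
    "set (snd ?K) = item_vars Js" "item_ok a k ?K"
    using K setIs by auto
  show "x \<in> set qs"
    by fact
  show "mset (item_holes (eliminate x Is)) = mset (item_holes Is)"
    unfolding el concat_mset by (simp add: quantify_def K)
  show quants: "mset (item_quants (eliminate x Is)) = mset (item_quants Is) + {#x#}"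
    unfolding el concat_mset by (simp add: quantify_def K)
  have setq: "set (item_quants (eliminate x Is)) = insert x (set (item_quants Is))"
    using arg_cong[OF quants, of set_mset] by (simp del: set_concat)
  have vars: "item_vars (eliminate x Is) = item_vars Is - {x}"
    unfolding el setIs using K(3) Ks by (auto simp: quantify_def)
  have "distinct (item_quants (eliminate x Is) @ removeAll x qs)"
  proof -
    \<comment> \<open>As \<open>qs\<close> has no repetitions, \<open>x\<close> just moves from
      \<open>qs\<close> to the quantifiers of the items, and the combined multiset is
      unchanged.\<close>
    have "removeAll x qs = remove1 x qs"
      using dist by (simp add: distinct_remove1_removeAll)
    then have "mset (item_quants (eliminate x Is) @ removeAll x qs) = mset (item_quants Is @ qs)"
      using quants x by simp
    then show ?thesis
      using dist mset_eq_imp_distinct_iff by blast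
  qed
  moreover have "\<forall>I\<in>set (eliminate x Is). item_ok a k I"
    unfolding el using K(4) quantify_ok ok setIs by auto
  moreover have "set (item_quants (eliminate x Is)) \<inter> item_vars (eliminate x Is) = {}"
    unfolding setq vars using disj by blast
  moreover have "item_vars (eliminate x Is) \<subseteq> W \<union> set (removeAll x qs)"
    unfolding vars using W(1) by auto
  moreover have "\<forall>I\<in>set (eliminate x Is). \<exists>B\<in>set (map (removeAll x) bags). set (snd I) \<subseteq> set B"
  proof
    fix I
    assume I: "I \<in> set (eliminate x Is)"
    then have "x \<notin> set (snd I)"
      using vars by blast
    moreover have "\<exists>B\<in>set bags. set (snd I) \<subseteq> set B"
    proof (cases "I \<in> set Ks")
      case True
      then show ?thesis
        using inbag setIs by blast
    next
      case False
      then have "set (snd I) \<subseteq> set C"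
        using I C(2) K(3) unfolding el by (auto simp: quantify_def)
      then show ?thesis
        using C(1) by blast
    qed
    ultimately show "\<exists>B\<in>set (map (removeAll x) bags). set (snd I) \<subseteq> set B"
      by auto
  qed
  moreover have "\<forall>B\<in>set (map (removeAll x) bags). card (set B) \<le> k"
    using card by (auto intro: order_trans[OF card_Diff1_le])
  moreover have "eliminate x Is \<noteq> []"
    unfolding el by simp
  ultimately show "solver_invariant a k W (removeAll x qs) (eliminate x Is) (map (removeAll x) bags)"
    unfolding solver_invariant_def using W(2,3) eliminable_remove[OF elim x] by simp
qed

lemma solve_correct:
  assumes "solver_invariant a k W qs Is bags" "n = length qs"
  defines "G \<equiv> solve n qs Is bags"
  shows "ex_and_formula G \<and> width a G \<le> k \<and> mset (hole_list G) = mset (item_holes Is) \<and>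
    mset (quantified_vars G) = mset (item_quants Is @ qs) \<and> standardized a G"
  using assms(1,2) unfolding G_def
proof (induction n arbitrary: qs Is bags)
  case 0
  then have "Is \<noteq> []" and ok: "\<And>I. I \<in> set Is \<Longrightarrow> item_ok a k I"
    and disj: "set (item_quants Is) \<inter> item_vars Is = {}"
    and W: "item_vars Is \<subseteq> W" "finite W" "card W \<le> k" and "distinct (item_quants Is)"
    unfolding solver_invariant_def by auto
  have "card (item_vars Is) \<le> k"
    using W card_mono order_trans by metis
  note K = conj_items_correct[of Is a k, OF \<open>Is \<noteq> []\<close> ok this]
  show ?case
    using K disj \<open>distinct (item_quants Is)\<close> 0 unfolding item_ok_def standardized_def
    by (simp del: set_concat)
next
  case (Suc n)
  let ?x = "pick qs bags"
  have "qs \<noteq> []"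
    using Suc.prems by auto
  note st = solver_step[OF Suc.prems(1) this]
  have "distinct qs"
    using Suc.prems unfolding solver_invariant_def by simp
  then have rem: "removeAll ?x qs = remove1 ?x qs"
    by (simp add: distinct_remove1_removeAll)
  then have "n = length (removeAll ?x qs)"
    using Suc.prems(2) st(1) by (simp add: length_remove1)
  note IH = Suc.IH[OF st(2) this]
  have "mset (item_quants (eliminate ?x Is) @ removeAll ?x qs) = mset (item_quants Is @ qs)"
    using st(1,4) rem by simp
  then show ?case
    using IH st(3) by (simp add: Let_def)
qed

section \<open>From tree decompositions to formulas of the class\<close>

lemma tree_decomposition_eliminable:
  assumes "tree_decomposition (hypergraph_of \<phi> a) D" "standardized a \<phi>"
    and "set qs = set (quantified_vars \<phi>)" "set ` set bags = bag D ` nodes D"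
  shows "eliminable qs bags"
  unfolding eliminable_def
proof (intro allI impI)
  fix Q'
  assume Q': "Q' \<subseteq> set qs" "Q' \<noteq> {}"
  have e: "free a \<phi> \<in> hedges (hypergraph_of \<phi> a)"
    by (simp add: hypergraph_of_def)
  have sub: "hverts (hypergraph_of \<phi> a) \<subseteq> free a \<phi> \<union> set qs"
    using holes_subset_free assms(3) by (simp add: hypergraph_of_def)
  obtain x t where x: "x \<in> Q'" "t \<in> nodes D"
    and xt: "\<forall>t'\<in>nodes D. x \<in> bag D t' \<longrightarrow> bag D t' - (set qs - Q') \<subseteq> bag D t"
    using simplicial_variable[OF assms(1) e sub _ Q'] by auto
  have "bag D t \<in> set ` set bags"
    using x(2) unfolding assms(4) by (rule imageI)
  then obtain B where B: "B \<in> set bags" "set B = bag D t"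
    by auto
  have "set B' - (set qs - Q') \<subseteq> set B" if "B' \<in> set bags" "x \<in> set B'" for B'
  proof -
    have "set B' \<in> bag D ` nodes D"
      using that(1) unfolding assms(4)[symmetric] by (rule imageI)
    then show ?thesis
      using xt that(2) B(2) by auto
  qed
  then show "\<exists>x\<in>Q'. \<exists>B\<in>set bags. \<forall>B'\<in>set bags. x \<in> set B' \<longrightarrow> set B' - (set qs - Q') \<subseteq> set B"
    using x(1) B(1) by blast
qed

lemma tree_decomposition_finite:
  assumes D: "tree_decomposition (hypergraph_of \<phi> a) D" and "association a \<phi>"
  shows "finite (nodes D)" "t \<in> nodes D \<Longrightarrow> finite (bag D t)"
proof -
  have "finite (hverts (hypergraph_of \<phi> a))"
    using assms(2) unfolding association_def hypergraph_of_def by (simp add: holes_def)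
  moreover have "t \<in> nodes D \<Longrightarrow> bag D t \<subseteq> hverts (hypergraph_of \<phi> a)"
    using D by (simp add: tree_decomposition_def)
  ultimately show "t \<in> nodes D \<Longrightarrow> finite (bag D t)"
    using finite_subset by blast
  show "finite (nodes D)"
    using D by (simp add: tree_decomposition_def tree_graph_def)
qed

text \<open>The start has one item per hole and no quantifier placed. Arbitrary listings are
  allowed, so that both the width equation and the program can appeal to this lemma.\<close>

lemma solve_tree_decomposition:
  assumes \<phi>: "holey_formula \<phi>" "ex_and_formula \<phi>" "association a \<phi>" "standardized a \<phi>"
    and D: "tree_decomposition (hypergraph_of \<phi> a) D"
    and qs: "mset qs = mset (quantified_vars \<phi>)"
    and al: "lists_association al \<phi> a"
    and bags: "set ` set bags = bag D ` nodes D"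
  defines "G \<equiv> solve (length qs) qs (map (\<lambda>(i, xs). (Hole i, xs)) al) bags"
  shows "G \<in> rewrite_class a \<phi>" "width a G \<le> bagsize D"
proof -
  let ?H = "hypergraph_of \<phi> a" and ?Is = "map (\<lambda>(i, xs). (Hole i, xs)) al"
  note fin = tree_decomposition_finite(1)[OF D \<phi>(3)] and finbag = tree_decomposition_finite(2)[OF D \<phi>(3)]
  have card: "card (bag D t) \<le> bagsize D" if "t \<in> nodes D" for t
    unfolding bagsize_def using fin that by simp
  have card_sub: "card S \<le> bagsize D" if "t \<in> nodes D" "S \<subseteq> bag D t" for S t
    using card_mono[OF finbag[OF that(1)] that(2)] card[OF that(1)] by simp
  have setqs: "set qs = set (quantified_vars \<phi>)"
    using qs by (rule mset_eq_setD)
  have al_set: "set (map fst al) = holes \<phi>" "distinct (map fst al)"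
    and al_vars: "\<And>i xs. (i, xs) \<in> set al \<Longrightarrow> set xs = the (a i)"
    using al unfolding lists_association_def lists_set_def by auto
  have holes: "item_holes ?Is = map fst al"
    by (induction al) auto
  have quants: "item_quants ?Is = []"
    by (induction al) auto
  have hole_mem: "i \<in> holes \<phi>" if "(i, xs) \<in> set al" for i xs
    using al_set(1) that by force
  have edge: "\<exists>t\<in>nodes D. e \<subseteq> bag D t" if "e \<in> hedges ?H" for e
    using D that by (simp add: tree_decomposition_def)
  have hole_edge: "\<exists>t\<in>nodes D. the (a i) \<subseteq> bag D t" if "i \<in> holes \<phi>" for i
    using edge that by (auto simp: hypergraph_of_def)
  obtain r where r: "r \<in> nodes D" "free a \<phi> \<subseteq> bag D r"
    using edge[of "free a \<phi>"] by (auto simp: hypergraph_of_def)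
  have "?Is \<noteq> []"
  proof
    assume "?Is = []"
    then have "holes \<phi> = {}"
      using al_set(1) by simp
    then show False
      by (simp add: holes_def)
  qed
  moreover have "distinct (item_quants ?Is @ qs)"
    unfolding quants using mset_eq_imp_distinct_iff[OF qs] \<phi>(4) unfolding standardized_def by simp
  moreover have "item_ok a (bagsize D) I" if "I \<in> set ?Is" for I
  proof -
    obtain i xs where I: "I = (Hole i, xs)" "(i, xs) \<in> set al"
      using \<open>I \<in> set ?Is\<close> by auto
    obtain t where "t \<in> nodes D" "the (a i) \<subseteq> bag D t"
      using hole_edge[OF hole_mem[OF I(2)]] by blast
    then have "card (the (a i)) \<le> bagsize D"
      by (rule card_sub)
    then show ?thesis
      using al_vars[OF I(2)] I(1) by (simp add: item_ok_def width_le_iff)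
  qed
  moreover have "item_vars ?Is \<subseteq> free a \<phi> \<union> set qs"
  proof -
    have "item_vars ?Is \<subseteq> (\<Union>i\<in>holes \<phi>. the (a i))"
    proof
      fix v
      assume "v \<in> item_vars ?Is"
      then obtain i xs where i: "(i, xs) \<in> set al" and "v \<in> set xs"
        by auto
      then show "v \<in> (\<Union>i\<in>holes \<phi>. the (a i))"
        using hole_mem[OF i] al_vars[OF i] by auto
    qed
    then show ?thesis
      using holes_subset_free[of a \<phi>] unfolding setqs by blast
  qed
  moreover have "finite (free a \<phi>)" "card (free a \<phi>) \<le> bagsize D"
    using finite_subset[OF r(2) finbag[OF r(1)]] card_sub[OF r] by auto
  moreover have "\<exists>B\<in>set bags. set (snd I) \<subseteq> set B" if "I \<in> set ?Is" for I
  proof -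
    obtain i xs where I: "I = (Hole i, xs)" "(i, xs) \<in> set al"
      using \<open>I \<in> set ?Is\<close> by auto
    obtain t where t: "t \<in> nodes D" "set xs \<subseteq> bag D t"
      using hole_edge[OF hole_mem[OF I(2)]] al_vars[OF I(2)] by auto
    have "bag D t \<in> set ` set bags"
      using t(1) unfolding bags by (rule imageI)
    then show ?thesis
      using t(2) I(1) by auto
  qed
  moreover have "card (set B) \<le> bagsize D" if "B \<in> set bags" for B
  proof -
    have "set B \<in> bag D ` nodes D"
      using that unfolding bags[symmetric] by (rule imageI)
    then show ?thesis
      using card by auto
  qed
  ultimately have "solver_invariant a (bagsize D) (free a \<phi>) qs ?Is bags"
    unfolding solver_invariant_def
    using quants tree_decomposition_eliminable[OF D \<phi>(4) setqs bags] by simp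
  note G = solve_correct[OF this refl, folded G_def]
  show "width a G \<le> bagsize D"
    using G by blast
  have "mset (map fst al) = mset (hole_list \<phi>)"
    using al_set \<phi>(1) unfolding holey_formula_def holes_def
    by (intro set_eq_iff_mset_eq_distinct[THEN iffD1]) auto
  then have "mset (hole_list G) = mset (hole_list \<phi>)"
    using G holes by simp
  then show "G \<in> rewrite_class a \<phi>"
    using G quants qs \<phi>(2,4) by (intro rewrite_classI) auto
qed

lemma width_class_ge:
  assumes "standardized a \<phi>" "\<psi> \<in> rewrite_class a \<phi>"
  shows "min_bagsize (hypergraph_of \<phi> a) \<le> width a \<psi>"
proof -
  obtain D where "tree_decomposition (hypergraph_of \<psi> a) D" "bagsize D = width a \<psi>"
    using syntax_tree_decomposition[OF rewrite_class_standardized[OF assms(2,1)]] by blast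
  then show ?thesis
    unfolding min_bagsize_def rewrite_class_hypergraph[OF assms(2)]
    by (metis (mono_tags) wellorder_Inf_le1 imageI mem_Collect_eq)
qed

lemma width_set_eq:
  assumes \<phi>: "holey_formula \<phi>" "ex_and_formula \<phi>" "association a \<phi>" "standardized a \<phi>"
  shows "width_set a (rewrite_class a \<phi>) = min_bagsize (hypergraph_of \<phi> a)"
proof -
  let ?H = "hypergraph_of \<phi> a"
  have "{D. tree_decomposition ?H D} \<noteq> {}"
    using syntax_tree_decomposition[OF \<phi>(4)] by auto
  then have "min_bagsize ?H \<in> bagsize ` {D. tree_decomposition ?H D}"
    unfolding min_bagsize_def by (intro Inf_nat_def1) simp
  then obtain D where D: "tree_decomposition ?H D" "bagsize D = min_bagsize ?H"
    by auto
  note fin = tree_decomposition_finite(1)[OF D(1) \<phi>(3)] and finbag = tree_decomposition_finite(2)[OF D(1) \<phi>(3)]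
  \<comment> \<open>Any listing of bags and association will do: this half is about existence
    only.\<close>
  define bags where "bags = map (\<lambda>t. sorted_list_of_set (bag D t)) (sorted_list_of_set (nodes D))"
  define al where "al = map (\<lambda>i. (i, sorted_list_of_set (the (a i)))) (hole_list \<phi>)"
  have bags: "set ` set bags = bag D ` nodes D"
    unfolding bags_def using fin finbag by (auto simp: image_image)
  have al: "lists_association al \<phi> a"
    using \<phi>(1,3) unfolding lists_association_def lists_set_def al_def association_def holey_formula_def
    by (auto simp: holes_def comp_def)
  obtain G where G: "G \<in> rewrite_class a \<phi>" "width a G \<le> bagsize D"
    using solve_tree_decomposition[OF \<phi> D(1) refl al bags] by blast
  have "width_set a (rewrite_class a \<phi>) \<le> width a G"
    unfolding width_set_def using G(1) by (intro cInf_lower) auto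
  moreover have "min_bagsize ?H \<le> width_set a (rewrite_class a \<phi>)"
    unfolding width_set_def using G(1) width_class_ge[OF \<phi>(4)] by (intro cInf_greatest) auto
  ultimately show ?thesis
    using G(2) D(2) by simp
qed

section \<open>The program and its running time\<close>

text \<open>\<open>Suc 0\<close> is the form into which the simplifier brings 1, so
  \<open>prog_nth\<close> keeps matching.\<close>

abbreviation (input) f_eq :: nat where "f_eq \<equiv> Suc 0"
abbreviation (input) f_mem :: nat where "f_mem \<equiv> 2"
abbreviation (input) f_subset :: nat where "f_subset \<equiv> 3"
abbreviation (input) f_simplicial :: nat where "f_simplicial \<equiv> 4"
abbreviation (input) f_exists :: nat where "f_exists \<equiv> 5"
abbreviation (input) f_pick :: nat where "f_pick \<equiv> 6"
abbreviation (input) f_remove :: nat where "f_remove \<equiv> 7"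
abbreviation (input) f_remove_all :: nat where "f_remove_all \<equiv> 8"
abbreviation (input) f_append :: nat where "f_append \<equiv> 9"
abbreviation (input) f_quants :: nat where "f_quants \<equiv> 10"
abbreviation (input) f_items :: nat where "f_items \<equiv> 11"
abbreviation (input) f_bags :: nat where "f_bags \<equiv> 12"
abbreviation (input) f_with :: nat where "f_with \<equiv> 13"
abbreviation (input) f_without :: nat where "f_without \<equiv> 14"
abbreviation (input) f_conj :: nat where "f_conj \<equiv> 15"
abbreviation (input) f_quantify :: nat where "f_quantify \<equiv> 16"
abbreviation (input) f_eliminate :: nat where "f_eliminate \<equiv> 17"
abbreviation (input) f_solve :: nat where "f_solve \<equiv> 18"

text \<open>\<open>Leaf\<close> is false, so a \<open>Match\<close> on a test has its negative
  branch first. A positive answer is a node, and its two subtrees shift all indices of the positive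
  branch by two.\<close>

abbreviation (input) trueE :: expr where "trueE \<equiv> NodeE LeafE LeafE"

text \<open>After three matches the environment begins with the bag list, the edge list and the
  association. The quantified variables are passed twice, the first time as fuel.\<close>

definition main_body :: expr where
  "main_body = Match (Var 0) LeafE (Match (Var 1) LeafE (Match (Var 1) LeafE
     (LetE (Call f_quants [Var 4, LeafE])
       (Call f_solve [Var 0, Var 0, Call f_items [Var 3], Call f_bags [Var 1]]))))"

definition eq_body :: expr where
  "eq_body = Match (Var 0) (Match (Var 1) trueE LeafE)
     (Match (Var 3) LeafE (Match (Call f_eq [Var 2, Var 0]) LeafE (Call f_eq [Var 5, Var 3])))"

definition mem_body :: expr where
  "mem_body = Match (Var 1) LeafE
     (Match (Call f_eq [Var 2, Var 0]) (Call f_mem [Var 2, Var 1]) trueE)"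

definition subset_body :: expr where
  "subset_body = Match (Var 0) trueE
     (Match (Call f_mem [Var 0, Var 3]) LeafE (Call f_subset [Var 3, Var 5]))"

definition simplicial_body :: expr where
  "simplicial_body = Match (Var 2) trueE
     (Match (Call f_mem [Var 2, Var 0]) (Call f_simplicial [Var 2, Var 3, Var 1])
       (Match (Call f_subset [Var 2, Var 5]) LeafE (Call f_simplicial [Var 6, Var 7, Var 5])))"

definition exists_body :: expr where
  "exists_body = Match (Var 1) LeafE
     (Match (Call f_simplicial [Var 2, Var 0, Var 4]) (Call f_exists [Var 2, Var 1, Var 4]) trueE)"

definition pick_body :: expr where
  "pick_body = Match (Var 0) LeafE
     (Match (Call f_exists [Var 0, Var 3, Var 3]) (Call f_pick [Var 1, Var 3]) (Var 2))"

definition remove_body :: expr where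
  "remove_body = Match (Var 1) LeafE
     (Match (Call f_eq [Var 2, Var 0]) (NodeE (Var 0) (Call f_remove [Var 2, Var 1]))
       (Call f_remove [Var 4, Var 3]))"

definition remove_all_body :: expr where
  "remove_all_body = Match (Var 1) LeafE
     (NodeE (Call f_remove [Var 2, Var 0]) (Call f_remove_all [Var 2, Var 1]))"

definition append_body :: expr where
  "append_body = Match (Var 0) (Var 1) (NodeE (Var 0) (Call f_append [Var 1, Var 3]))"

text \<open>The second argument is an accumulator, which saves appending and keeps the time linear.
  The left subtree of a code is its tag: \<open>Leaf\<close> for holes, otherwise a node whose right
  subtree separates \<open>Bin\<close> from \<open>Qu\<close>.\<close>

definition quants_body :: expr where
  "quants_body = Match (Var 0) LeafE (Match (Var 0) (Var 3) (Match (Var 1)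
     (Match (Var 3) LeafE (Match (Var 1) LeafE (Call f_quants [Var 0, Call f_quants [Var 1, Var 9]])))
     (Match (Var 5) LeafE (Match (Var 1) LeafE (NodeE (Var 0) (Call f_quants [Var 1, Var 11]))))))"

definition items_body :: expr where
  "items_body = Match (Var 0) LeafE (Match (Var 0) LeafE
     (NodeE (NodeE (NodeE LeafE (Var 0)) (Var 1)) (Call f_items [Var 3])))"

definition bags_body :: expr where
  "bags_body = Match (Var 0) LeafE (Match (Var 0) LeafE (NodeE (Var 1) (Call f_bags [Var 3])))"

definition with_body :: expr where
  "with_body = Match (Var 1) LeafE (Match (Var 0) LeafE
     (Match (Call f_mem [Var 4, Var 1]) (Call f_with [Var 4, Var 3])
       (NodeE (Var 4) (Call f_with [Var 6, Var 5]))))"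

definition without_body :: expr where
  "without_body = Match (Var 1) LeafE (Match (Var 0) LeafE
     (Match (Call f_mem [Var 4, Var 1]) (NodeE (Var 2) (Call f_without [Var 4, Var 3]))
       (Call f_without [Var 6, Var 5])))"

text \<open>Here \<open>trueE\<close> is no truth value: the first one is the code of
  \<open>Hole 0\<close>, the second one the tag of \<open>Bin\<close>, followed by
  \<open>LeafE\<close> for \<open>Conj\<close>.\<close>

definition conj_body :: expr where
  "conj_body = Match (Var 0) (NodeE trueE LeafE) (Match (Var 1) (Var 0)
     (LetE (Call f_conj [Var 3]) (Match (Var 0) LeafE (Match (Var 5) LeafE
       (NodeE (NodeE trueE (NodeE LeafE (NodeE (Var 0) (Var 2)))) (Call f_append [Var 1, Var 3]))))))"

definition quantify_body :: expr where
  "quantify_body = Match (Var 1) LeafE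
     (NodeE (NodeE (NodeE LeafE trueE) (NodeE LeafE (NodeE (Var 2) (Var 0))))
       (Call f_remove [Var 2, Var 1]))"

definition eliminate_body :: expr where
  "eliminate_body = LetE (Call f_with [Var 0, Var 1]) (Match (Var 0)
     (Match (Var 2) LeafE (NodeE (Call f_quantify [Var 3, Var 0]) (Var 1)))
     (NodeE (Call f_quantify [Var 3, Call f_conj [Var 2]]) (Call f_without [Var 3, Var 4])))"

text \<open>The first argument, a list as long as the second one, bounds the depth of the recursion.\<close>

definition solve_body :: expr where
  "solve_body = Match (Var 0) (Match (Call f_conj [Var 2]) LeafE (Var 0))
     (LetE (Call f_pick [Var 3, Var 5])
       (Call f_solve [Var 2, Call f_remove [Var 0, Var 4], Call f_eliminate [Var 0, Var 5],
         Call f_remove_all [Var 0, Var 6]]))"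

definition prog :: program where
  "prog = [main_body, eq_body, mem_body, subset_body, simplicial_body, exists_body, pick_body,
     remove_body, remove_all_body, append_body, quants_body, items_body, bags_body, with_body,
     without_body, conj_body, quantify_body, eliminate_body, solve_body]"

section \<open>Symbolic execution with running times\<close>

text \<open>Calls are kept folded, as \<open>wpc\<close>, so that rewriting with the equations for \<open>wp\<close> terminates.\<close>

definition wp :: "val list \<Rightarrow> expr \<Rightarrow> (val \<Rightarrow> nat \<Rightarrow> bool) \<Rightarrow> bool" where
  "wp env e Q \<longleftrightarrow> (\<exists>v n. eval prog env e v n \<and> Q v n)"

definition wps :: "val list \<Rightarrow> expr list \<Rightarrow> (val list \<Rightarrow> nat \<Rightarrow> bool) \<Rightarrow> bool" where
  "wps env es Q \<longleftrightarrow> (\<exists>vs n. evals prog env es vs n \<and> Q vs n)"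

definition wpc :: "nat \<Rightarrow> val list \<Rightarrow> (val \<Rightarrow> nat \<Rightarrow> bool) \<Rightarrow> bool" where
  "wpc f vs Q \<longleftrightarrow> wp vs (prog ! f) Q"

definition computes :: "nat \<Rightarrow> val list \<Rightarrow> val \<Rightarrow> nat \<Rightarrow> bool" where
  "computes f vs v t \<longleftrightarrow> wp vs (prog ! f) (\<lambda>w n. w = v \<and> n \<le> t)"

lemma wp_Var: "wp env (Var i) Q \<longleftrightarrow> i < length env \<and> Q (env ! i) 1"
  unfolding wp_def by (subst eval.simps) auto

lemma wp_LeafE: "wp env LeafE Q \<longleftrightarrow> Q Leaf 1"
  unfolding wp_def by (subst eval.simps) auto

lemma wp_NodeE: "wp env (NodeE e\<^sub>1 e\<^sub>2) Q \<longleftrightarrow>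
    wp env e\<^sub>1 (\<lambda>u m. wp env e\<^sub>2 (\<lambda>v n. Q (Node u v) (m + n + 1)))"
  unfolding wp_def by (subst eval.simps) fastforce

lemma wp_Match: "wp env (Match e e\<^sub>1 e\<^sub>2) Q \<longleftrightarrow>
    wp env e (\<lambda>c m. case c of Leaf \<Rightarrow> wp env e\<^sub>1 (\<lambda>w n. Q w (m + n + 1))
      | Node u v \<Rightarrow> wp (u # v # env) e\<^sub>2 (\<lambda>w n. Q w (m + n + 1)))"
  unfolding wp_def by (subst eval.simps) (fastforce split: val.splits)

lemma wp_LetE: "wp env (LetE e e\<^sub>1) Q \<longleftrightarrow>
    wp env e (\<lambda>u m. wp (u # env) e\<^sub>1 (\<lambda>v n. Q v (m + n + 1)))"
  unfolding wp_def by (subst eval.simps) fastforce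

lemma wp_Call: "wp env (Call f es) Q \<longleftrightarrow>
    f < length prog \<and> wps env es (\<lambda>vs m. wpc f vs (\<lambda>v n. Q v (m + n + 1)))"
  unfolding wp_def wps_def wpc_def by (subst eval.simps) fastforce

lemma wps_Nil: "wps env [] Q \<longleftrightarrow> Q [] 0"
  unfolding wps_def by (subst evals.simps) auto

lemma wps_Cons: "wps env (e # es) Q \<longleftrightarrow>
    wp env e (\<lambda>v m. wps env es (\<lambda>vs n. Q (v # vs) (m + n)))"
  unfolding wp_def wps_def by (subst evals.simps) fastforce

lemma length_prog: "length prog = 19"
  by (simp add: prog_def)

lemma prog_nth:
  "prog ! 0 = main_body" "prog ! f_eq = eq_body" "prog ! f_mem = mem_body"
  "prog ! f_subset = subset_body" "prog ! f_simplicial = simplicial_body"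
  "prog ! f_exists = exists_body" "prog ! f_pick = pick_body" "prog ! f_remove = remove_body"
  "prog ! f_remove_all = remove_all_body" "prog ! f_append = append_body"
  "prog ! f_quants = quants_body" "prog ! f_items = items_body" "prog ! f_bags = bags_body"
  "prog ! f_with = with_body" "prog ! f_without = without_body" "prog ! f_conj = conj_body"
  "prog ! f_quantify = quantify_body" "prog ! f_eliminate = eliminate_body"
  "prog ! f_solve = solve_body"
  by (simp_all add: prog_def)

lemmas wp_simps = wp_Var wp_LeafE wp_NodeE wp_Match wp_LetE wp_Call wps_Nil wps_Cons length_prog prog_nth

lemma computesI: "wp vs (prog ! f) (\<lambda>w n. w = v \<and> n \<le> t) \<Longrightarrow> computes f vs v t"
  by (simp add: computes_def)

lemma wpcI: "computes f vs v t \<Longrightarrow> (\<And>n. n \<le> t \<Longrightarrow> Q v n) \<Longrightarrow> wpc f vs Q"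
  unfolding computes_def wpc_def wp_def by blast

lemma computes_mono: "computes f vs v s \<Longrightarrow> s \<le> t \<Longrightarrow> computes f vs v t"
  unfolding computes_def wp_def by force

definition enc_bool :: "bool \<Rightarrow> val" where
  "enc_bool b = (if b then Node Leaf Leaf else Leaf)"

lemma enc_bool_simps [simp]: "enc_bool True = Node Leaf Leaf" "enc_bool False = Leaf"
  by (simp_all add: enc_bool_def)

abbreviation enc_vars :: "nat list \<Rightarrow> val" where "enc_vars \<equiv> enc_list enc_nat"
abbreviation enc_item :: "item \<Rightarrow> val" where "enc_item \<equiv> enc_pair enc_form enc_vars"

lemma enc_pair_simp [simp]: "enc_pair f g (x, y) = Node (f x) (g y)"
  by (simp add: enc_pair_def)

lemma enc_nat_0: "enc_nat 0 = Leaf"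
  by (simp add: enc_nat.simps)

text \<open>The program compares codes instead of numbers. This is sound because the lowest bit and
  the half determine a number.\<close>

lemma enc_nat_inject [simp]: "enc_nat m = enc_nat n \<longleftrightarrow> m = n"
proof
  show "enc_nat m = enc_nat n \<Longrightarrow> m = n"
  proof (induction m arbitrary: n rule: less_induct)
    case (less m)
    show ?case
    proof (cases "m = 0 \<or> n = 0")
      case True
      then show ?thesis
        using less.prems by (auto simp: enc_nat.simps[of m] enc_nat.simps[of n] split: if_splits)
    next
      case False
      then have "enc_nat (m div 2) = enc_nat (n div 2)" "even m = even n"
        using less.prems by (auto simp: enc_nat.simps[of m] enc_nat.simps[of n] split: if_splits)
      moreover from this have "m div 2 = n div 2"
        using less.IH[of "m div 2"] False by auto
      ultimately show ?thesis
        by (metis dvd_mult_div_cancel odd_two_times_div_two_succ)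
    qed
  qed
qed simp

lemma size_enc_list: "size (enc_list f xs) = (\<Sum>x\<leftarrow>xs. size (f x)) + length xs"
  by (induction xs) auto

section \<open>Time bounds and correctness of the functions\<close>

text \<open>One parameter \<open>M\<close>, finally the size of the input, bounds all numbers and
  lengths involved. A factor \<open>Suc M\<close> counts the calls of a recursion, including the one
  on the empty list; the numerals are generous allowances for the steps of a body.\<close>

definition t_eq :: "nat \<Rightarrow> nat" where "t_eq M = 40 * M + 20"
definition t_mem :: "nat \<Rightarrow> nat" where "t_mem M = Suc M * (t_eq M + 20)"
definition t_subset :: "nat \<Rightarrow> nat" where "t_subset M = Suc M * (t_mem M + 20)"
definition t_simplicial :: "nat \<Rightarrow> nat" where "t_simplicial M = Suc M * (t_mem M + t_subset M + 30)"
definition t_exists :: "nat \<Rightarrow> nat" where "t_exists M = Suc M * (t_simplicial M + 20)"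
definition t_pick :: "nat \<Rightarrow> nat" where "t_pick M = Suc M * (t_exists M + 20)"
definition t_remove :: "nat \<Rightarrow> nat" where "t_remove M = Suc M * (t_eq M + 20)"
definition t_remove_all :: "nat \<Rightarrow> nat" where "t_remove_all M = Suc M * (t_remove M + 20)"
definition t_append :: "nat \<Rightarrow> nat" where "t_append M = Suc M * 20"
definition t_filter :: "nat \<Rightarrow> nat" where "t_filter M = Suc M * (t_mem M + 20)"
definition t_conj :: "nat \<Rightarrow> nat" where "t_conj M = Suc M * (t_append M + 40)"
definition t_quantify :: "nat \<Rightarrow> nat" where "t_quantify M = t_remove M + 30"
definition t_eliminate :: "nat \<Rightarrow> nat" where
  "t_eliminate M = 2 * t_filter M + t_conj M + t_quantify M + 40"
definition t_solve :: "nat \<Rightarrow> nat" where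
  "t_solve M = Suc M * (t_pick M + t_remove M + t_eliminate M + t_remove_all M + t_conj M + 40)"
text \<open>\<open>80 * Suc M\<close> pays for reading the input: 40 per unit for the quantifiers,
  20 each for the items and the bags.\<close>

definition t_main :: "nat \<Rightarrow> nat" where "t_main M = t_solve M + 80 * Suc M + 40"

lemma computes_iterate: "computes f vs v (Suc l * K) \<Longrightarrow> l \<le> M \<Longrightarrow> computes f vs v (Suc M * K)"
  by (erule computes_mono) simp

text \<open>\<open>size\<close> counts inner nodes only, so \<open>2 * size u + 1\<close> is the
  number of all nodes of \<open>u\<close>. At most one call of 20 steps is spent on each.\<close>

lemma eq_computes: "computes f_eq [u, v] (enc_bool (u = v)) (20 * (2 * size u + 1))"
proof (induction u arbitrary: v)
  case Leaf
  show ?case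
    by (rule computesI) (cases v; simp add: eq_body_def wp_simps)
next
  case (Node u\<^sub>1 u\<^sub>2)
  show ?case
  proof (cases v)
    case Leaf
    then show ?thesis
      by (intro computesI) (simp add: eq_body_def wp_simps)
  next
    case v: (Node v\<^sub>1 v\<^sub>2)
    show ?thesis
      unfolding v
      apply (rule computesI, simp add: eq_body_def wp_simps)
      apply (rule wpcI[OF Node.IH(1)])
      apply (cases "u\<^sub>1 = v\<^sub>1"; simp add: wp_simps)
      apply (rule wpcI[OF Node.IH(2)])
      apply simp
      done
  qed
qed

lemma eq_nat_computes:
  assumes "size (enc_nat x) \<le> M"
  shows "computes f_eq [enc_nat x, enc_nat y] (enc_bool (x = y)) (t_eq M)"
  using computes_mono[OF eq_computes[of "enc_nat x" "enc_nat y"], of "t_eq M"] assms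
  by (simp add: t_eq_def)

lemma mem_computes:
  assumes "size (enc_nat x) \<le> M" "length ys \<le> M"
  shows "computes f_mem [enc_nat x, enc_vars ys] (enc_bool (x \<in> set ys)) (t_mem M)"
proof -
  have "computes f_mem [enc_nat x, enc_vars ys] (enc_bool (x \<in> set ys))
      (Suc (length ys) * (t_eq M + 20))"
  proof (induction ys)
    case Nil
    show ?case
      by (rule computesI) (simp add: mem_body_def wp_simps)
  next
    case (Cons y ys)
    show ?case
      apply (rule computesI, simp add: mem_body_def wp_simps)
      apply (rule wpcI[OF eq_nat_computes[OF assms(1)]])
      apply (cases "x = y"; simp add: wp_simps)
      apply (rule wpcI[OF Cons.IH])
      apply simp
      done
  qed
  then show ?thesis
    unfolding t_mem_def using assms(2) by (rule computes_iterate)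
qed

definition small_list :: "nat \<Rightarrow> nat list \<Rightarrow> bool" where
  "small_list M xs \<longleftrightarrow> length xs \<le> M \<and> (\<forall>x\<in>set xs. size (enc_nat x) \<le> M)"

lemma small_list_length: "small_list M xs \<Longrightarrow> length xs \<le> M"
  by (simp add: small_list_def)

lemma subset_computes:
  assumes "small_list M xs" "small_list M ys"
  shows "computes f_subset [enc_vars xs, enc_vars ys] (enc_bool (set xs \<subseteq> set ys)) (t_subset M)"
proof -
  have "\<forall>x\<in>set xs. size (enc_nat x) \<le> M"
    using assms(1) by (simp add: small_list_def)
  then have "computes f_subset [enc_vars xs, enc_vars ys] (enc_bool (set xs \<subseteq> set ys))
      (Suc (length xs) * (t_mem M + 20))"
  proof (induction xs)
    case Nil
    show ?case
      by (rule computesI) (simp add: subset_body_def wp_simps)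
  next
    case (Cons x xs)
    then have x: "size (enc_nat x) \<le> M"
      and IH: "computes f_subset [enc_vars xs, enc_vars ys] (enc_bool (set xs \<subseteq> set ys))
        (Suc (length xs) * (t_mem M + 20))"
      by auto
    show ?case
      apply (rule computesI, simp add: subset_body_def wp_simps)
      apply (rule wpcI[OF mem_computes[OF x small_list_length[OF assms(2)]]])
      apply (cases "x \<in> set ys"; simp add: wp_simps)
      apply (rule wpcI[OF IH])
      apply simp
      done
  qed
  then show ?thesis
    unfolding t_subset_def using assms(1) by (rule computes_iterate[OF _ small_list_length])
qed

definition small_lists :: "nat \<Rightarrow> nat list list \<Rightarrow> bool" where
  "small_lists M bags \<longleftrightarrow> length bags \<le> M \<and> (\<forall>B\<in>set bags. small_list M B)"

lemma simplicial_computes: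
  assumes "size (enc_nat x) \<le> M" "small_list M B" "small_lists M bags"
  shows "computes f_simplicial [enc_nat x, enc_vars B, enc_list enc_vars bags]
    (enc_bool (simplicial x B bags)) (t_simplicial M)"
proof -
  have "\<forall>B\<in>set bags. small_list M B"
    using assms(3) by (simp add: small_lists_def)
  then have "computes f_simplicial [enc_nat x, enc_vars B, enc_list enc_vars bags]
      (enc_bool (simplicial x B bags)) (Suc (length bags) * (t_mem M + t_subset M + 30))"
  proof (induction bags)
    case Nil
    show ?case
      by (rule computesI) (simp add: simplicial_body_def wp_simps simplicial_def)
  next
    case (Cons C bags)
    then have C: "small_list M C"
      and IH: "computes f_simplicial [enc_nat x, enc_vars B, enc_list enc_vars bags]
        (enc_bool (simplicial x B bags)) (Suc (length bags) * (t_mem M + t_subset M + 30))"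
      by auto
    show ?case
      apply (rule computesI, simp add: simplicial_body_def wp_simps)
      apply (rule wpcI[OF mem_computes[OF assms(1) small_list_length[OF C]]])
      apply (cases "x \<in> set C"; simp add: wp_simps)
       apply (rule wpcI[OF subset_computes[OF C assms(2)]])
       apply (cases "set C \<subseteq> set B"; simp add: wp_simps)
        apply (rule wpcI[OF IH], simp add: simplicial_def)
       apply (simp add: simplicial_def)
      apply (rule wpcI[OF IH], simp add: simplicial_def)
      done
  qed
  then show ?thesis
    unfolding t_simplicial_def using assms(3)[unfolded small_lists_def] by (blast intro: computes_iterate)
qed

lemma exists_computes:
  assumes "size (enc_nat x) \<le> M" "small_lists M Bs" "small_lists M bags"
  shows "computes f_exists [enc_nat x, enc_list enc_vars Bs, enc_list enc_vars bags]
    (enc_bool (\<exists>B\<in>set Bs. simplicial x B bags)) (t_exists M)"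
proof -
  have "\<forall>B\<in>set Bs. small_list M B"
    using assms(2) by (simp add: small_lists_def)
  then have "computes f_exists [enc_nat x, enc_list enc_vars Bs, enc_list enc_vars bags]
      (enc_bool (\<exists>B\<in>set Bs. simplicial x B bags)) (Suc (length Bs) * (t_simplicial M + 20))"
  proof (induction Bs)
    case Nil
    show ?case
      by (rule computesI) (simp add: exists_body_def wp_simps)
  next
    case (Cons B Bs)
    then have B: "small_list M B"
      and IH: "computes f_exists [enc_nat x, enc_list enc_vars Bs, enc_list enc_vars bags]
        (enc_bool (\<exists>B\<in>set Bs. simplicial x B bags)) (Suc (length Bs) * (t_simplicial M + 20))"
      by auto
    show ?case
      apply (rule computesI, simp add: exists_body_def wp_simps)
      apply (rule wpcI[OF simplicial_computes[OF assms(1) B assms(3)]])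
      apply (cases "simplicial x B bags"; simp add: wp_simps)
      apply (rule wpcI[OF IH])
      apply simp
      done
  qed
  then show ?thesis
    unfolding t_exists_def using assms(2)[unfolded small_lists_def] by (blast intro: computes_iterate)
qed

lemma pick_computes:
  assumes "small_list M qs" "small_lists M bags"
  shows "computes f_pick [enc_vars qs, enc_list enc_vars bags] (enc_nat (pick qs bags)) (t_pick M)"
proof -
  have "\<forall>x\<in>set qs. size (enc_nat x) \<le> M"
    using assms(1) by (simp add: small_list_def)
  then have "computes f_pick [enc_vars qs, enc_list enc_vars bags] (enc_nat (pick qs bags))
      (Suc (length qs) * (t_exists M + 20))"
  proof (induction qs)
    case Nil
    show ?case
      by (rule computesI) (simp add: pick_body_def wp_simps enc_nat_0)
  next
    case (Cons q qs)
    then have q: "size (enc_nat q) \<le> M"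
      and IH: "computes f_pick [enc_vars qs, enc_list enc_vars bags] (enc_nat (pick qs bags))
        (Suc (length qs) * (t_exists M + 20))"
      by auto
    show ?case
      apply (rule computesI, simp add: pick_body_def wp_simps split del: if_split)
      apply (rule wpcI[OF exists_computes[OF q assms(2,2)]])
      apply (cases "\<exists>B\<in>set bags. simplicial q B bags"; simp add: wp_simps)
      apply (rule wpcI[OF IH])
      apply simp
      done
  qed
  then show ?thesis
    unfolding t_pick_def using assms(1) by (rule computes_iterate[OF _ small_list_length])
qed

lemma remove_computes:
  assumes "size (enc_nat x) \<le> M" "length ys \<le> M"
  shows "computes f_remove [enc_nat x, enc_vars ys] (enc_vars (removeAll x ys)) (t_remove M)"
proof -
  have "computes f_remove [enc_nat x, enc_vars ys] (enc_vars (removeAll x ys))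
      (Suc (length ys) * (t_eq M + 20))"
  proof (induction ys)
    case Nil
    show ?case
      by (rule computesI) (simp add: remove_body_def wp_simps)
  next
    case (Cons y ys)
    show ?case
      apply (rule computesI, simp add: remove_body_def wp_simps split del: if_split)
      apply (rule wpcI[OF eq_nat_computes[OF assms(1)]])
      apply (cases "y = x"; simp add: wp_simps; rule wpcI[OF Cons.IH]; simp)
      done
  qed
  then show ?thesis
    unfolding t_remove_def using assms(2) by (rule computes_iterate)
qed

lemma remove_all_computes:
  assumes "size (enc_nat x) \<le> M" "small_lists M bags"
  shows "computes f_remove_all [enc_nat x, enc_list enc_vars bags]
    (enc_list enc_vars (map (removeAll x) bags)) (t_remove_all M)"
proof -
  have "\<forall>B\<in>set bags. length B \<le> M"
    using assms(2) by (simp add: small_lists_def small_list_def)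
  then have "computes f_remove_all [enc_nat x, enc_list enc_vars bags]
    (enc_list enc_vars (map (removeAll x) bags)) (Suc (length bags) * (t_remove M + 20))"
  proof (induction bags)
    case Nil
    show ?case
      by (rule computesI) (simp add: remove_all_body_def wp_simps)
  next
    case (Cons B bags)
    then have B: "length B \<le> M"
      and IH: "computes f_remove_all [enc_nat x, enc_list enc_vars bags]
        (enc_list enc_vars (map (removeAll x) bags)) (Suc (length bags) * (t_remove M + 20))"
      by auto
    show ?case
      apply (rule computesI, simp add: remove_all_body_def wp_simps)
      apply (rule wpcI[OF remove_computes[OF assms(1) B]], simp add: wp_simps)
      apply (rule wpcI[OF IH], simp)
      done
  qed
  then show ?thesis
    unfolding t_remove_all_def using assms(2)[unfolded small_lists_def] by (blast intro: computes_iterate)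
qed

lemma append_computes:
  assumes "length xs \<le> M"
  shows "computes f_append [enc_vars xs, enc_vars ys] (enc_vars (xs @ ys)) (t_append M)"
proof -
  have "computes f_append [enc_vars xs, enc_vars ys] (enc_vars (xs @ ys)) (Suc (length xs) * 20)"
  proof (induction xs)
    case Nil
    show ?case
      by (rule computesI) (simp add: append_body_def wp_simps)
  next
    case (Cons x xs)
    show ?case
      apply (rule computesI, simp add: append_body_def wp_simps)
      apply (rule wpcI[OF Cons.IH], simp)
      done
  qed
  then show ?thesis
    unfolding t_append_def using assms by (rule computes_iterate)
qed

lemma quants_computes:
  "computes f_quants [enc_form \<phi>, enc_vars ys] (enc_vars (quantified_vars \<phi> @ ys))
    (40 * size (enc_form \<phi>))"
proof (induction \<phi> arbitrary: ys)
  case (Hole i)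
  show ?case
    by (rule computesI) (simp add: quants_body_def wp_simps)
next
  case (Bin c F G)
  show ?case
    apply (rule computesI, simp add: quants_body_def wp_simps)
    apply (rule wpcI[OF Bin.IH(2)])
    apply (rule wpcI[OF Bin.IH(1)], simp)
    done
next
  case (Qu Q x F)
  show ?case
    apply (rule computesI, simp add: quants_body_def wp_simps)
    apply (rule wpcI[OF Qu.IH], simp)
    done
qed

abbreviation enc_entries :: "(nat \<times> nat list) list \<Rightarrow> val" where
  "enc_entries \<equiv> enc_list (enc_pair enc_nat enc_vars)"

lemma items_computes:
  "computes f_items [enc_entries al] (enc_list enc_item (map (\<lambda>(i, xs). (Hole i, xs)) al))
    (Suc (length al) * 20)"
proof (induction al)
  case Nil
  show ?case
    by (rule computesI) (simp add: items_body_def wp_simps)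
next
  case (Cons p al)
  show ?case
    apply (cases p, rule computesI, simp add: items_body_def wp_simps)
    apply (rule wpcI[OF Cons.IH], simp)
    done
qed

lemma bags_computes:
  "computes f_bags [enc_entries bl] (enc_list enc_vars (map snd bl)) (Suc (length bl) * 20)"
proof (induction bl)
  case Nil
  show ?case
    by (rule computesI) (simp add: bags_body_def wp_simps)
next
  case (Cons p bl)
  show ?case
    apply (cases p, rule computesI, simp add: bags_body_def wp_simps)
    apply (rule wpcI[OF Cons.IH], simp)
    done
qed

text \<open>Merging items concatenates their lists of variables without removing duplicates; their total
  length does not grow.\<close>

abbreviation vars_length :: "item list \<Rightarrow> nat" where
  "vars_length Is \<equiv> (\<Sum>I\<leftarrow>Is. length (snd I))"

lemma filter_computes:
  assumes "size (enc_nat x) \<le> M" "length Is \<le> M" "vars_length Is \<le> M"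
  shows "computes f_with [enc_nat x, enc_list enc_item Is]
      (enc_list enc_item (filter (\<lambda>I. x \<in> set (snd I)) Is)) (t_filter M)" (is ?with)
    and "computes f_without [enc_nat x, enc_list enc_item Is]
      (enc_list enc_item (filter (\<lambda>I. x \<notin> set (snd I)) Is)) (t_filter M)" (is ?without)
proof -
  have "computes f_with [enc_nat x, enc_list enc_item Is]
      (enc_list enc_item (filter (\<lambda>I. x \<in> set (snd I)) Is)) (Suc (length Is) * (t_mem M + 20)) \<and>
    computes f_without [enc_nat x, enc_list enc_item Is]
      (enc_list enc_item (filter (\<lambda>I. x \<notin> set (snd I)) Is)) (Suc (length Is) * (t_mem M + 20))"
    using assms(3)
  proof (induction Is)
    case Nil
    show ?case
      by (intro conjI computesI) (simp_all add: with_body_def without_body_def wp_simps)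
  next
    case (Cons I Is)
    obtain F vs where I: "I = (F, vs)"
      by (cases I)
    have vs: "length vs \<le> M"
      and IH: "computes f_with [enc_nat x, enc_list enc_item Is]
          (enc_list enc_item (filter (\<lambda>I. x \<in> set (snd I)) Is)) (Suc (length Is) * (t_mem M + 20))"
        "computes f_without [enc_nat x, enc_list enc_item Is]
          (enc_list enc_item (filter (\<lambda>I. x \<notin> set (snd I)) Is)) (Suc (length Is) * (t_mem M + 20))"
      using Cons I by auto
    have "computes f_with [enc_nat x, enc_list enc_item (I # Is)]
        (enc_list enc_item (filter (\<lambda>I. x \<in> set (snd I)) (I # Is)))
        (Suc (length (I # Is)) * (t_mem M + 20))"
      unfolding I
      apply (rule computesI, simp add: with_body_def wp_simps split del: if_split)
      apply (rule wpcI[OF mem_computes[OF assms(1) vs]])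
      apply (cases "x \<in> set vs"; simp add: wp_simps; rule wpcI[OF IH(1)]; simp)
      done
    moreover have "computes f_without [enc_nat x, enc_list enc_item (I # Is)]
        (enc_list enc_item (filter (\<lambda>I. x \<notin> set (snd I)) (I # Is)))
        (Suc (length (I # Is)) * (t_mem M + 20))"
      unfolding I
      apply (rule computesI, simp add: without_body_def wp_simps split del: if_split)
      apply (rule wpcI[OF mem_computes[OF assms(1) vs]])
      apply (cases "x \<in> set vs"; simp add: wp_simps; rule wpcI[OF IH(2)]; simp)
      done
    ultimately show ?case
      by blast
  qed
  then show ?with ?without
    unfolding t_filter_def using assms(2) by (auto intro: computes_iterate simp del: mult_Suc)
qed

lemma conj_computes:
  assumes "length Is \<le> M" "vars_length Is \<le> M"
  shows "computes f_conj [enc_list enc_item Is] (enc_item (conj_items Is)) (t_conj M)"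
proof -
  have "computes f_conj [enc_list enc_item Is] (enc_item (conj_items Is))
      (Suc (length Is) * (t_append M + 40))"
    using assms(2)
  proof (induction Is rule: conj_items.induct)
    case 1
    show ?case
      by (rule computesI) (simp add: conj_body_def wp_simps enc_pair_def enc_nat_0)
  next
    case (2 I)
    show ?case
      by (rule computesI) (simp add: conj_body_def wp_simps enc_pair_def)
  next
    case (3 I J Is)
    then have I: "length (snd I) \<le> M"
      and IH: "computes f_conj [enc_list enc_item (J # Is)] (enc_item (conj_items (J # Is)))
        (Suc (length (J # Is)) * (t_append M + 40))"
      by auto
    show ?case
      apply (rule computesI, simp add: conj_body_def wp_simps)
      apply (rule wpcI[OF IH[simplified]], simp add: wp_simps enc_pair_def)
      apply (rule wpcI[OF append_computes[OF I]], simp add: Let_def)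
      done
  qed
  then show ?thesis
    unfolding t_conj_def using assms(1) by (rule computes_iterate)
qed

lemma quantify_computes:
  assumes "size (enc_nat x) \<le> M" "length (snd I) \<le> M"
  shows "computes f_quantify [enc_nat x, enc_item I] (enc_item (quantify x I)) (t_quantify M)"
  apply (rule computesI, simp add: quantify_body_def wp_simps enc_pair_def)
  apply (rule wpcI[OF remove_computes[OF assms]], simp add: quantify_def t_quantify_def)
  done

lemma length_conj_items: "length (snd (conj_items Is)) = vars_length Is"
  by (induction Is rule: conj_items.induct) (auto simp: Let_def)

lemma vars_length_filter: "vars_length (filter P Is) \<le> vars_length Is"
  by (induction Is) auto

lemma eliminate_computes:
  assumes "size (enc_nat x) \<le> M" "length Is \<le> M" "vars_length Is \<le> M"
  shows "computes f_eliminate [enc_nat x, enc_list enc_item Is]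
    (enc_list enc_item (eliminate x Is)) (t_eliminate M)"
proof -
  note flt = filter_computes[OF assms]
  show ?thesis
  proof (cases "filter (\<lambda>I. x \<in> set (snd I)) Is")
    case Nil
    show ?thesis
    proof (cases Is)
      case Is: Nil
      show ?thesis
        apply (rule computesI, simp add: eliminate_body_def wp_simps)
        apply (rule wpcI[OF flt(1)], simp add: Is wp_simps eliminate_def t_eliminate_def)
        done
    next
      case (Cons I Is')
      then have I: "length (snd I) \<le> M"
        using assms(3) by simp
      show ?thesis
        apply (rule computesI, simp add: eliminate_body_def wp_simps)
        apply (rule wpcI[OF flt(1)], simp only: Nil, simp add: Cons wp_simps)
        apply (rule wpcI[OF quantify_computes[OF assms(1) I]])
        apply (use Nil Cons in \<open>simp add: eliminate_def t_eliminate_def\<close>)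
        done
    qed
  next
    case (Cons J Js)
    have "length (J # Js) \<le> M" "vars_length (J # Js) \<le> M"
      unfolding Cons[symmetric] using assms(2,3) vars_length_filter[of "\<lambda>I. x \<in> set (snd I)" Is]
      by (auto intro: order_trans[OF length_filter_le])
    note J = conj_computes[OF this] and
      q = quantify_computes[OF assms(1), of "conj_items (J # Js)", unfolded length_conj_items, OF this(2)]
    show ?thesis
      apply (rule computesI, simp add: eliminate_body_def wp_simps)
      apply (rule wpcI[OF flt(1)], simp only: Cons, simp add: wp_simps)
      apply (rule wpcI[OF J[simplified]])
      apply (rule wpcI[OF q])
      apply (rule wpcI[OF flt(2)])
      apply (simp add: eliminate_def Cons t_eliminate_def)
      done
  qed
qed

text \<open>A merged item replaces at least one item and lists no more variables than its parts
  together. Hence the bounds read off the input hold in every round.\<close>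

lemma eliminate_bounds:
  "length (eliminate x Is) \<le> length Is" "vars_length (eliminate x Is) \<le> vars_length Is"
proof -
  have *: "length (eliminate x Is) \<le> length Is \<and> vars_length (eliminate x Is) \<le> vars_length Is"
  proof (cases "Is = []")
    case True
    then show ?thesis
      by (simp add: eliminate_def)
  next
    case False
    then obtain Js Ks where J: "Js \<noteq> []" "mset Is = mset Js + mset Ks"
      "eliminate x Is = quantify x (conj_items Js) # Ks"
      using eliminate_cases by metis
    \<comment> \<open>As a multiset sum the total length does not depend on how the items are split
      into \<open>Js\<close> and \<open>Ks\<close>.\<close>
    have "vars_length Is = sum_mset (image_mset (\<lambda>I. length (snd I)) (mset Is))" for Is :: "item list"
      by (metis mset_map sum_mset_sum_list)
    then have "vars_length Is = vars_length Js + vars_length Ks"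
      using J(2) by simp
    moreover have "length Is = length Js + length Ks"
      using J(2) by (metis size_mset size_union)
    moreover have "length (removeAll x (snd (conj_items Js))) \<le> vars_length Js"
      unfolding length_conj_items[symmetric] by (rule length_removeAll_less_eq)
    ultimately show ?thesis
      using J(1,3) by (cases Js) (auto simp: quantify_def)
  qed
  then show "length (eliminate x Is) \<le> length Is" "vars_length (eliminate x Is) \<le> vars_length Is"
    by auto
qed

lemma small_list_removeAll: "small_list M xs \<Longrightarrow> small_list M (removeAll x xs)"
  unfolding small_list_def by (auto intro: order_trans[OF length_removeAll_less_eq])

text \<open>This holds for all bags, so the time analysis is independent of the correctness
  argument; in either case the code of the picked variable is small.\<close>

lemma pick_mem: "pick qs bags = 0 \<or> pick qs bags \<in> set qs"
  by (induction qs) auto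

text \<open>The assumptions bound the variable lists but not the formulas of the items, because the
  program only moves these around and never looks inside.\<close>

lemma solve_computes:
  assumes "length fuel \<le> M" "small_list M qs" "length Is \<le> M" "vars_length Is \<le> M" "small_lists M bags"
  shows "computes f_solve [enc_vars fuel, enc_vars qs, enc_list enc_item Is, enc_list enc_vars bags]
    (enc_form (solve (length fuel) qs Is bags)) (t_solve M)"
proof -
  let ?K = "t_pick M + t_remove M + t_eliminate M + t_remove_all M + t_conj M + 40"
  have "computes f_solve [enc_vars fuel, enc_vars qs, enc_list enc_item Is, enc_list enc_vars bags]
    (enc_form (solve (length fuel) qs Is bags)) (Suc (length fuel) * ?K)"
    using assms(2-5)
  proof (induction fuel arbitrary: qs Is bags)
    case Nil
    show ?case
      apply (rule computesI, simp add: solve_body_def wp_simps)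
      apply (rule wpcI[OF conj_computes[OF Nil(2,3)]], simp add: wp_simps enc_pair_def)
      done
  next
    case (Cons y fuel)
    let ?x = "pick qs bags"
    have x: "size (enc_nat ?x) \<le> M"
      using pick_mem[of qs bags] Cons.prems(1) by (auto simp: small_list_def enc_nat_0)
    have bags': "small_lists M (map (removeAll ?x) bags)"
      using Cons.prems(4) small_list_removeAll unfolding small_lists_def by auto
    note IH = Cons.IH[OF small_list_removeAll[OF Cons.prems(1)]
      order_trans[OF eliminate_bounds(1) Cons.prems(2)]
      order_trans[OF eliminate_bounds(2) Cons.prems(3)] bags']
    show ?case
      apply (rule computesI, simp add: solve_body_def wp_simps)
      apply (rule wpcI[OF pick_computes[OF Cons.prems(1,4)]])
      apply (rule wpcI[OF remove_computes[OF x small_list_length[OF Cons.prems(1)]]])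
      apply (rule wpcI[OF eliminate_computes[OF x Cons.prems(2,3)]])
      apply (rule wpcI[OF remove_all_computes[OF x Cons.prems(4)]])
      apply (rule wpcI[OF IH], simp add: Let_def)
      done
  qed
  then show ?thesis
    unfolding t_solve_def using assms(1) by (rule computes_iterate)
qed

lemma size_enc_list_ge: "x \<in> set xs \<Longrightarrow> size (f x) < size (enc_list f xs)"
  by (induction xs) auto

lemma small_list_enc: "size (enc_vars xs) \<le> M \<Longrightarrow> small_list M xs"
  unfolding small_list_def using size_enc_list_ge[of _ xs enc_nat]
  by (fastforce simp: size_enc_list)

lemma small_list_quants: "small_list (size (enc_form \<phi>)) (quantified_vars \<phi>)"
  unfolding small_list_def by (induction \<phi>) (auto intro: le_SucI trans_le_add1 trans_le_add2)

lemma main_computes: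
  fixes \<phi> :: hform and al bl :: "(nat \<times> nat list) list"
  defines "qs \<equiv> quantified_vars \<phi>"
  assumes inp: "inp = Node (enc_form \<phi>) (Node (enc_entries al) (Node (enc_entries bl) v))"
  shows "computes 0 [inp]
    (enc_form (solve (length qs) qs (map (\<lambda>(i, xs). (Hole i, xs)) al) (map snd bl))) (t_main (size inp))"
proof -
  let ?M = "size inp" and ?Is = "map (\<lambda>(i, xs). (Hole i, xs)) al"
  have sizes: "size (enc_form \<phi>) \<le> ?M" "size (enc_entries al) \<le> ?M" "size (enc_entries bl) \<le> ?M"
    by (simp_all add: inp)
  have qs: "small_list ?M qs"
    using small_list_quants[of \<phi>] sizes(1) unfolding qs_def small_list_def by fastforce
  have "length al + vars_length ?Is \<le> size (enc_entries al)"
    by (induction al) (auto simp: enc_pair_def size_enc_list)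
  then have Is: "length ?Is \<le> ?M" "vars_length ?Is \<le> ?M"
    using sizes(2) by auto
  have "small_list ?M (snd p)" if "p \<in> set bl" for p
    using size_enc_list_ge[OF that, of "enc_pair enc_nat enc_vars"] sizes(3)
    by (intro small_list_enc) (simp add: enc_pair_def)
  moreover have "length bl \<le> ?M"
    using sizes(3) by (simp add: size_enc_list)
  ultimately have bags: "small_lists ?M (map snd bl)"
    by (auto simp: small_lists_def)
  note quants = quants_computes[of \<phi> "[]", simplified, folded qs_def]
  show ?thesis
    apply (rule computesI, simp add: main_body_def wp_simps inp)
    apply (rule wpcI[OF quants])
    apply (rule wpcI[OF items_computes])
    apply (rule wpcI[OF bags_computes])
    apply (rule wpcI[OF solve_computes[OF small_list_length[OF qs] qs Is bags]])
    apply (use Is(1) sizes \<open>length bl \<le> ?M\<close> in \<open>simp add: t_main_def inp\<close>)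
    done
qed

section \<open>Polynomial bound and conclusion\<close>

text \<open>Equality with a polynomial, instead of an upper bound, makes closure under sums and
  products immediate.\<close>

definition polynomial_bound :: "(nat \<Rightarrow> nat) \<Rightarrow> bool" where
  "polynomial_bound f \<longleftrightarrow> (\<exists>q. \<forall>n. f n = poly q n)"

lemma polynomial_bound_intros:
  "polynomial_bound (\<lambda>n. n)" "polynomial_bound (\<lambda>n. c)"
  "polynomial_bound f \<Longrightarrow> polynomial_bound g \<Longrightarrow> polynomial_bound (\<lambda>n. f n + g n)"
  "polynomial_bound f \<Longrightarrow> polynomial_bound g \<Longrightarrow> polynomial_bound (\<lambda>n. f n * g n)"
proof -
  show "polynomial_bound (\<lambda>n. n)"
    unfolding polynomial_bound_def by (rule exI[of _ "[:0, 1:]"]) simp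
  show "polynomial_bound (\<lambda>n. c)"
    unfolding polynomial_bound_def by (rule exI[of _ "[:c:]"]) simp
  show "polynomial_bound f \<Longrightarrow> polynomial_bound g \<Longrightarrow> polynomial_bound (\<lambda>n. f n + g n)"
    unfolding polynomial_bound_def by (metis poly_add)
  show "polynomial_bound f \<Longrightarrow> polynomial_bound g \<Longrightarrow> polynomial_bound (\<lambda>n. f n * g n)"
    unfolding polynomial_bound_def by (metis poly_mult)
qed

lemma t_main_polynomial: "polynomial_bound t_main"
  unfolding t_main_def t_solve_def t_eliminate_def t_quantify_def t_conj_def t_filter_def
    t_append_def t_remove_all_def t_remove_def t_pick_def t_exists_def t_simplicial_def
    t_subset_def t_mem_def t_eq_def Suc_eq_plus1
  by (intro polynomial_bound_intros)

theorem theorem8p2: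
  shows "(\<forall>\<phi> a. holey_formula \<phi> \<and> ex_and_formula \<phi> \<and> association a \<phi> \<and> standardized a \<phi> \<longrightarrow>
            int (width_set a (rewrite_class a \<phi>)) = tw (hypergraph_of \<phi> a) + 1)
    \<and> (\<exists>(P :: program) (q :: nat poly). \<forall>\<phi> a D inp.
          holey_formula \<phi> \<and> ex_and_formula \<phi> \<and> association a \<phi> \<and> standardized a \<phi> \<and>
          tree_decomposition (hypergraph_of \<phi> a) D \<and> encodes_input inp \<phi> a D \<longrightarrow>
          (\<exists>\<phi>' n. runs P inp (enc_form \<phi>') n \<and> n \<le> poly q (size inp) \<and>
             \<phi>' \<in> rewrite_class a \<phi> \<and>
             width a \<phi>' \<le> bagsize D \<and>
             (minimum_width (hypergraph_of \<phi> a) D \<longrightarrow> width a \<phi>' = bagsize D)))"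
proof (intro conjI)
  show "\<forall>\<phi> a. holey_formula \<phi> \<and> ex_and_formula \<phi> \<and> association a \<phi> \<and> standardized a \<phi> \<longrightarrow>
      int (width_set a (rewrite_class a \<phi>)) = tw (hypergraph_of \<phi> a) + 1"
    using width_set_eq by (simp add: tw_def)
  obtain q where q: "\<And>n. t_main n = poly q n"
    using t_main_polynomial unfolding polynomial_bound_def by auto
  have "\<exists>\<phi>' n. runs prog inp (enc_form \<phi>') n \<and> n \<le> poly q (size inp) \<and>
      \<phi>' \<in> rewrite_class a \<phi> \<and> width a \<phi>' \<le> bagsize D \<and>
      (minimum_width (hypergraph_of \<phi> a) D \<longrightarrow> width a \<phi>' = bagsize D)"
    if \<phi>: "holey_formula \<phi>" "ex_and_formula \<phi>" "association a \<phi>" "standardized a \<phi>"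
      and D: "tree_decomposition (hypergraph_of \<phi> a) D" and enc: "encodes_input inp \<phi> a D"
    for \<phi> a D inp
  proof -
    obtain al bl v where al: "lists_association al \<phi> a"
      and bl: "lists_set (map fst bl) (nodes D)" "\<forall>(t, xs)\<in>set bl. lists_set xs (bag D t)"
      and inp: "inp = Node (enc_form \<phi>) (Node (enc_entries al) (Node (enc_entries bl) v))"
      using enc unfolding encodes_input_def lists_tree_decomp_def by auto
    \<comment> \<open>The solver sees only the family of bags; this identifies the listed family
      with that of \<open>D\<close>.\<close>
    have "set ` set (map snd bl) = (\<lambda>p. set (snd p)) ` set bl"
      by (simp add: image_image)
    also have "\<dots> = (\<lambda>p. bag D (fst p)) ` set bl"
      using bl(2) by (intro image_cong) (auto simp: lists_set_def)
    also have "\<dots> = bag D ` fst ` set bl"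
      by (simp add: image_image)
    also have "\<dots> = bag D ` nodes D"
      using bl(1) by (simp add: lists_set_def)
    finally have bags: "set ` set (map snd bl) = bag D ` nodes D" .
    define G where "G = solve (length (quantified_vars \<phi>)) (quantified_vars \<phi>)
      (map (\<lambda>(i, xs). (Hole i, xs)) al) (map snd bl)"
    have G: "G \<in> rewrite_class a \<phi>" "width a G \<le> bagsize D"
      using solve_tree_decomposition[OF \<phi> D refl al bags] unfolding G_def by blast+
    obtain n where "eval prog [inp] (prog ! 0) (enc_form G) n" "n \<le> t_main (size inp)"
      using main_computes[OF inp] unfolding G_def computes_def wp_def by auto
    then have "runs prog inp (enc_form G) n" "n \<le> poly q (size inp)"
      using q by (auto simp: runs_def prog_def)
    \<comment> \<open>No formula of the class is narrower than the least bag size, so the upper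
      bound becomes an equality.\<close>
    moreover have "minimum_width (hypergraph_of \<phi> a) D \<Longrightarrow> width a G = bagsize D"
      using width_class_ge[OF \<phi>(4) G(1)] G(2) by (simp add: minimum_width_def)
    ultimately show ?thesis
      using G by blast
  qed
  then show "\<exists>(P :: program) (q :: nat poly). \<forall>\<phi> a D inp.
          holey_formula \<phi> \<and> ex_and_formula \<phi> \<and> association a \<phi> \<and> standardized a \<phi> \<and>
          tree_decomposition (hypergraph_of \<phi> a) D \<and> encodes_input inp \<phi> a D \<longrightarrow>
          (\<exists>\<phi>' n. runs P inp (enc_form \<phi>') n \<and> n \<le> poly q (size inp) \<and>
             \<phi>' \<in> rewrite_class a \<phi> \<and>
             width a \<phi>' \<le> bagsize D \<and>
             (minimum_width (hypergraph_of \<phi> a) D \<longrightarrow> width a \<phi>' = bagsize D))"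
    by (intro exI[of _ prog] exI[of _ q]) blast
qed

end
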